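(* Let $n\ge 1$ and let $\rho$ be an arbitrary density operator on a composite system $A_1,\dots,A_n$, with Hilbert space $\mathcal H_{A_1}\otimes\cdots\otimes\mathcal H_{A_n}$. Then the thermal global quantum discord of $\rho$ satisfies $$\mathcal D_{th}(A_1:\cdots:A_n)\;\ge\;\sum_{i=1}^{n}\ \min_{\Phi_{A_1\cdots A_{i-1}}}\ \mathcal D_{th}\big(\Phi_{A_1\cdots A_{i-1}}(\rho)\,\big|\,A_i\big),$$ where for $i\ge 2$ the minimum is over all local non-selective measurements $\Phi_{A_1\cdots A_{i-1}}$ on the subsystems $A_1,\dots,A_{i-1}$, and for $i=1$ the term is by convention $\mathcal D_{th}(\rho\,|\,A_1)$.
   Context: All Hilbert spaces are finite-dimensional; $\log=\log_2$; $S(\rho)=-\mathrm{Tr}\,\rho\log\rho$ is the von Neumann entropy and $H(\{p_a\})=-\sum_a p_a\log p_a$ is the Shannon entropy. A local measurement on a subsystem $A$ is a complete rank-one orthogonal projective measurement $\{\Pi_A^j\}$, i.e. the family of projectors onto the vectors of an orthonormal basis of $\mathcal H_A$. Non-selective measurements. For $1\le m\le n$ and a choice of local measurements $\{\Pi_{A_1}^{j_1}\},\dots,\{\Pi_{A_m}^{j_m}\}$ on $A_1,\dots,A_m$, $$\Phi_{A_1\cdots A_m}(\rho)=\sum_{j_1,\dots,j_m}\big(\Pi_{A_1}^{j_1}\otimes\cdots\otimes\Pi_{A_m}^{j_m}\otimes I\big)\,\rho\,\big(\Pi_{A_1}^{j_1}\otimes\cdots\otimes\Pi_{A_m}^{j_m}\otimes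 I\big),$$ where $I$ is the identity on the remaining subsystems. Thermal global quantum discord (GQD) of $\rho$: $$\mathcal D_{th}(A_1:\cdots:A_n)=\min_{\Phi}\big[S(\Phi_{A_1\cdots A_n}(\rho))-S(\rho)\big],$$ the minimum being over all choices of local measurements on $A_1,\dots,A_n$. Asymmetric bipartite thermal quantum discord. For a state $\sigma$ of the composite system and a subsystem $A=A_i$, let $R$ denote the collection of all the other subsystems, and let $\sigma_A,\sigma_R$ be the reduced states. The quantum mutual information is $I(\sigma)=S(\sigma_R)+S(\sigma_A)-S(\sigma)$. For a local measurement $\{\Pi_A^j\}$ put $\Phi_A(\sigma)=\sum_j (I_R\otimes\Pi_A^j)\,\sigma\,(I_R\otimes\Pi_A^j)$ and $p_j=\mathrm{Tr}[(I_R\otimes\Pi_A^j)\sigma]$. Then $$\mathcal D_{th}(\sigma\,|\,A)=\min_{\{\Pi_A^j\}}\Big\{\big[I(\sigma)-I(\Phi_A(\sigma))\big]+\big[H(\{p_j\})-S(\sigma_A)\big]\Big\},$$ the minimum being over all local measurements on $A$. *)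

theory Defs
  imports "Jordan_Normal_Form.Schur_Decomposition"
begin

text \<open>
  A composite system is given by the list \<open>ds = [d\<^sub>0, \<dots>, d\<^sub>n\<^sub>-\<^sub>1]\<close> of the dimensions of its
  subsystems. The Hilbert space of subsystem \<open>k\<close> is \<open>\<complex>\<^sup>d\<close> with \<open>d = ds ! k\<close>, and operators on
  the tensor product are square matrices of size \<open>prod_list ds\<close>. Subsystems are numbered
  from 0.
\<close>

definition mat_sum :: "nat \<Rightarrow> nat \<Rightarrow> complex mat list \<Rightarrow> complex mat" where
  "mat_sum nr nc As = foldr (+) As (0\<^sub>m nr nc)"

definition mat_trace :: "complex mat \<Rightarrow> complex" where
  "mat_trace A = sum_list (diag_mat A)"

definition kron :: "complex mat \<Rightarrow> complex mat \<Rightarrow> complex mat" where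
  "kron A B = mat (dim_row A * dim_row B) (dim_col A * dim_col B)
     (\<lambda>(i, j). A $$ (i div dim_row B, j div dim_col B) * B $$ (i mod dim_row B, j mod dim_col B))"

definition tensor :: "complex mat list \<Rightarrow> complex mat" where
  "tensor As = foldr kron As (1\<^sub>m 1)"


subsection \<open>States and entropies\<close>

definition density_operator :: "nat \<Rightarrow> complex mat \<Rightarrow> bool" where
  "density_operator N \<rho> \<longleftrightarrow>
     \<rho> \<in> carrier_mat N N \<and> mat_adjoint \<rho> = \<rho> \<and>
     (\<forall>v \<in> carrier_vec N. 0 \<le> Re ((\<rho> *\<^sub>v v) \<bullet>c v)) \<and>
     mat_trace \<rho> = 1"

definition unitary_mat :: "nat \<Rightarrow> complex mat \<Rightarrow> bool" where
  "unitary_mat N U \<longleftrightarrow>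
     U \<in> carrier_mat N N \<and> U * mat_adjoint U = 1\<^sub>m N \<and> mat_adjoint U * U = 1\<^sub>m N"

text \<open>
  Functional calculus \<open>f(A)\<close> for Hermitian \<open>A\<close>. The result does not depend on which
  unitary diagonalisation is used, so the choice operator selects the unique value.
\<close>

definition mat_fun :: "(real \<Rightarrow> real) \<Rightarrow> complex mat \<Rightarrow> complex mat" where
  "mat_fun f A = (SOME B. \<exists>U (e :: nat \<Rightarrow> real).
     unitary_mat (dim_row A) U \<and>
     A = U * mat_diag (dim_row A) (\<lambda>k. of_real (e k)) * mat_adjoint U \<and>
     B = U * mat_diag (dim_row A) (\<lambda>k. of_real (f (e k))) * mat_adjoint U)"

text \<open>
  Since \<open>log 2 0 = 0\<close>, the convention \<open>0 log 0 = 0\<close> is built in to both entropies.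
\<close>

definition vn_entropy :: "complex mat \<Rightarrow> real" where
  "vn_entropy \<rho> = - Re (mat_trace (\<rho> * mat_fun (log 2) \<rho>))"

definition shannon_entropy :: "real list \<Rightarrow> real" where
  "shannon_entropy ps = - (\<Sum>p\<leftarrow>ps. p * log 2 p)"


subsection \<open>Reduced states\<close>

text \<open>
  Partial trace over all subsystems outside \<open>K\<close>: the sum of
  \<open>B \<sigma> B\<^sup>\<dagger>\<close> over all tensor products \<open>B\<close> whose factor at \<open>k\<close> is the identity if \<open>k \<in> K\<close> and a
  computational basis bra \<open>\<langle>a|\<close> (a matrix with one row) if \<open>k \<notin> K\<close>.
\<close>

definition bra :: "nat \<Rightarrow> nat \<Rightarrow> complex mat" where
  "bra d a = mat_of_rows d [unit_vec d a]"

definition reduced_state :: "nat list \<Rightarrow> nat set \<Rightarrow> complex mat \<Rightarrow> complex mat" where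
  "reduced_state ds K \<sigma> =
     (let N = prod_list (map (\<lambda>k. if k \<in> K then ds ! k else 1) [0..<length ds]);
          factors = map (\<lambda>k. if k \<in> K then [1\<^sub>m (ds ! k)] else map (bra (ds ! k)) [0..<ds ! k])
                      [0..<length ds]
      in mat_sum N N (map (\<lambda>Bs. tensor Bs * \<sigma> * mat_adjoint (tensor Bs)) (product_lists factors)))"

definition mutual_information :: "nat list \<Rightarrow> nat \<Rightarrow> complex mat \<Rightarrow> real" where
  "mutual_information ds i \<sigma> =
     vn_entropy (reduced_state ds (- {i}) \<sigma>) + vn_entropy (reduced_state ds {i} \<sigma>) - vn_entropy \<sigma>"


subsection \<open>Local measurements\<close>

text \<open>An orthonormal family of \<open>d\<close> vectors in \<open>\<complex>\<^sup>d\<close> is automatically a basis.\<close>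

definition orthonormal_basis :: "nat \<Rightarrow> complex vec list \<Rightarrow> bool" where
  "orthonormal_basis d bs \<longleftrightarrow>
     length bs = d \<and> set bs \<subseteq> carrier_vec d \<and>
     (\<forall>j < d. \<forall>k < d. bs ! j \<bullet>c bs ! k = (if j = k then 1 else 0))"

definition projector :: "complex vec \<Rightarrow> complex mat" where
  "projector v = mat (dim_vec v) (dim_vec v) (\<lambda>(i, j). v $ i * cnj (v $ j))"

definition local_measurements :: "nat \<Rightarrow> complex mat list set" where
  "local_measurements d = map projector ` {bs. orthonormal_basis d bs}"

definition measurement_choices :: "nat list \<Rightarrow> complex mat list list set" where
  "measurement_choices ds = {Ms. list_all2 (\<lambda>M d. M \<in> local_measurements d) Ms ds}"

text \<open>
  Non-selective measurement \<open>Ms\<close> of the first \<open>length Ms\<close> subsystems; \<open>product_lists Ms\<close>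
  runs through the tuples of projectors indexed by \<open>(j\<^sub>1, \<dots>, j\<^sub>m)\<close>.
\<close>

definition measure_first :: "nat list \<Rightarrow> complex mat list list \<Rightarrow> complex mat \<Rightarrow> complex mat" where
  "measure_first ds Ms \<rho> =
     mat_sum (prod_list ds) (prod_list ds)
       (map (\<lambda>Ps. let P = tensor (Ps @ map 1\<^sub>m (drop (length Ms) ds)) in P * \<rho> * P)
         (product_lists Ms))"

definition on_subsystem :: "nat list \<Rightarrow> nat \<Rightarrow> complex mat \<Rightarrow> complex mat" where
  "on_subsystem ds i A = tensor ((map 1\<^sub>m ds)[i := A])"

definition measure_at :: "nat list \<Rightarrow> nat \<Rightarrow> complex mat list \<Rightarrow> complex mat \<Rightarrow> complex mat" where
  "measure_at ds i M \<sigma> =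
     mat_sum (prod_list ds) (prod_list ds)
       (map (\<lambda>P. on_subsystem ds i P * \<sigma> * on_subsystem ds i P) M)"

definition outcome_probs :: "nat list \<Rightarrow> nat \<Rightarrow> complex mat list \<Rightarrow> complex mat \<Rightarrow> real list" where
  "outcome_probs ds i M \<sigma> = map (\<lambda>P. Re (mat_trace (on_subsystem ds i P * \<sigma>))) M"


subsection \<open>Thermal discord\<close>

text \<open>
  The minimum over local measurements is written as an infimum of real numbers. The sets of
  values are nonempty and bounded below, and the infimum is attained: orthonormal bases form a compact
  set and the entropies are continuous on density operators.
\<close>

definition thermal_gqd :: "nat list \<Rightarrow> complex mat \<Rightarrow> real" where
  "thermal_gqd ds \<rho> =
     (INF Ms \<in> measurement_choices ds. vn_entropy (measure_first ds Ms \<rho>) - vn_entropy \<rho>)"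

definition thermal_discord :: "nat list \<Rightarrow> nat \<Rightarrow> complex mat \<Rightarrow> real" where
  "thermal_discord ds i \<sigma> =
     (INF M \<in> local_measurements (ds ! i).
        (mutual_information ds i \<sigma> - mutual_information ds i (measure_at ds i M \<sigma>)) +
        (shannon_entropy (outcome_probs ds i M \<sigma>) - vn_entropy (reduced_state ds {i} \<sigma>)))"

end

(*
  For a local measurement Phi_A on A, the functional minimised in the asymmetric discord equals
  S(Phi_A(sigma)) - S(sigma): the state of the remaining subsystems is unchanged by Phi_A, and the
  state of A after the measurement is diagonal in the measured basis with the outcome probabilities
  as eigenvalues, so its von Neumann entropy is the Shannon entropy of the outcomes. Measuring
  A_1, ..., A_n one after the other therefore turns S(Phi_{A_1...A_n}(rho)) - S(rho) into a
  telescoping sum whose i-th term is at least D_th(Phi_{A_1...A_{i-1}}(rho) | A_i).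

  All the maps involved (measurements, partial traces) have Kraus operators that range over tensor
  products of families chosen independently in each factor, so identities between them can be
  verified factor by factor. Since the infima are taken over real numbers, the argument also needs
  that the entropies of all states on the system lie in a common bounded interval.
*)

theory Submission
  imports Defs "Jordan_Normal_Form.Spectral_Radius"
begin

text \<open>Lists of Kraus operators that describe the same operation rarely coincide: composing two
  tensor families lists the products in another order than tensoring the factorwise composites, and
  tracing out a measured factor in general uses more operators than tracing it out directly.
  Equality is therefore tested on the Choi kernel, which multiplies under tensor products and
  contracts under composition. Trace preservation is a condition on the same kernel, so it too can
  be checked factor by factor.

  A second obstacle is that \<open>mat_fun\<close> selects a unitary diagonalisation by choice.
  Entropy becomes computable only after the spectral theorem supplies a diagonalisation with real
  eigenvalues and sums over eigenvalues are shown not to depend on which one is used.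

  The entropy bound, dimension divided by \<open>ln 2\<close>, is far from the sharp logarithm of
  the dimension, but it needs no concavity argument, and any bound common to all states is enough
  for both nested infima.\<close>

section \<open>Adjoints, traces and finite sums of complex matrices\<close>

lemma dim_mat_adjoint [simp]:
  "dim_row (mat_adjoint A) = dim_col A" "dim_col (mat_adjoint A) = dim_row A"
  by (auto simp: mat_adjoint_def)

lemma mat_adjoint_carrier [simp]:
  "A \<in> carrier_mat n m \<Longrightarrow> mat_adjoint A \<in> carrier_mat m n"
  by auto

lemma index_mat_adjoint [simp]:
  fixes A :: "complex mat"
  assumes "i < dim_col A" "j < dim_row A"
  shows "mat_adjoint A $$ (i, j) = cnj (A $$ (j, i))"
  using assms by (simp add: mat_adjoint_def mat_of_rows_index)

lemma mat_adjoint_adjoint [simp]: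
  fixes A :: "complex mat"
  shows "mat_adjoint (mat_adjoint A) = A"
  by (rule eq_matI) auto

lemma mat_adjoint_mult:
  fixes A :: "complex mat"
  assumes "A \<in> carrier_mat n m" "B \<in> carrier_mat m k"
  shows "mat_adjoint (A * B) = mat_adjoint B * mat_adjoint A"
  by (rule eq_matI) (use assms in \<open>auto simp: scalar_prod_def mult.commute\<close>)

lemma mat_adjoint_add:
  fixes A :: "complex mat"
  assumes "A \<in> carrier_mat n m" "B \<in> carrier_mat n m"
  shows "mat_adjoint (A + B) = mat_adjoint A + mat_adjoint B"
  by (rule eq_matI) (use assms in auto)

lemma mat_adjoint_one [simp]: "mat_adjoint (1\<^sub>m n :: complex mat) = 1\<^sub>m n"
  by (rule eq_matI) auto

lemma mat_adjoint_zero [simp]: "mat_adjoint (0\<^sub>m n m :: complex mat) = 0\<^sub>m m n"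
  by (rule eq_matI) auto

lemma cscalar_prod_adjoint:
  fixes A :: "complex mat"
  assumes A: "A \<in> carrier_mat n m" and v: "v \<in> carrier_vec m" and w: "w \<in> carrier_vec n"
  shows "(A *\<^sub>v v) \<bullet>c w = v \<bullet>c (mat_adjoint A *\<^sub>v w)"
proof -
  have "(A *\<^sub>v v) \<bullet>c w = (\<Sum>i<n. \<Sum>j<m. A $$ (i, j) * v $ j * cnj (w $ i))"
    using assms by (simp add: scalar_prod_def sum_distrib_right lessThan_atLeast0)
  also have "\<dots> = (\<Sum>j<m. \<Sum>i<n. A $$ (i, j) * v $ j * cnj (w $ i))"
    by (rule sum.swap)
  also have "\<dots> = v \<bullet>c (mat_adjoint A *\<^sub>v w)"
    using assms by (auto simp: scalar_prod_def sum_distrib_left lessThan_atLeast0 ac_simps intro!: sum.cong)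
  finally show ?thesis .
qed

lemma mat_trace_eq_sum: "A \<in> carrier_mat n n \<Longrightarrow> mat_trace A = (\<Sum>i<n. A $$ (i, i))"
  by (simp add: mat_trace_def diag_mat_def sum_list_distinct_conv_sum_set lessThan_atLeast0)

lemma mat_trace_mult_comm:
  assumes "A \<in> carrier_mat n m" "B \<in> carrier_mat m n"
  shows "mat_trace (A * B) = mat_trace (B * A)"
proof -
  have "mat_trace (A * B) = (\<Sum>i<n. \<Sum>j<m. A $$ (i, j) * B $$ (j, i))"
    using assms by (subst mat_trace_eq_sum[of _ n]) (auto simp: scalar_prod_def lessThan_atLeast0)
  also have "\<dots> = (\<Sum>j<m. \<Sum>i<n. A $$ (i, j) * B $$ (j, i))"
    by (rule sum.swap)
  also have "\<dots> = mat_trace (B * A)"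
    using assms by (subst mat_trace_eq_sum[of _ m]) (auto simp: scalar_prod_def lessThan_atLeast0 mult.commute)
  finally show ?thesis .
qed

lemma mat_sum_simps [simp]:
  "mat_sum n m [] = 0\<^sub>m n m" "mat_sum n m (A # As) = A + mat_sum n m As"
  by (auto simp: mat_sum_def)

lemma dim_mat_sum [simp]:
  "dim_row (mat_sum n m As) = n" "dim_col (mat_sum n m As) = m"
  by (induction As) auto

lemma mat_sum_carrier [simp]: "mat_sum n m As \<in> carrier_mat n m"
  by (rule carrier_matI) simp_all

lemma index_mat_sum:
  assumes "set As \<subseteq> carrier_mat n m" "i < n" "j < m"
  shows "mat_sum n m As $$ (i, j) = (\<Sum>A\<leftarrow>As. A $$ (i, j))"
  using assms
proof (induction As)
  case (Cons A As)
  then show ?case by auto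
qed auto

lemma mat_adjoint_mat_sum:
  "set As \<subseteq> carrier_mat n m \<Longrightarrow> mat_adjoint (mat_sum n m As) = mat_sum m n (map mat_adjoint As)"
proof (induction As)
  case (Cons A As)
  then show ?case by (simp add: mat_adjoint_add[of _ n m])
qed auto

lemma mat_sum_mult_vec:
  assumes "set As \<subseteq> carrier_mat n m" "v \<in> carrier_vec m" "w \<in> carrier_vec n"
  shows "(mat_sum n m As *\<^sub>v v) \<bullet>c w = (\<Sum>A\<leftarrow>As. (A *\<^sub>v v) \<bullet>c w)"
  using assms
proof (induction As)
  case (Cons A As)
  then have A: "A \<in> carrier_mat n m" by simp
  have "(mat_sum n m (A # As) *\<^sub>v v) \<bullet>c w = (A *\<^sub>v v + mat_sum n m As *\<^sub>v v) \<bullet>c w"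
    using A Cons.prems by (simp add: add_mult_distrib_mat_vec[of _ n m])
  also have "\<dots> = (A *\<^sub>v v) \<bullet>c w + (mat_sum n m As *\<^sub>v v) \<bullet>c w"
    using A Cons.prems by (intro add_scalar_prod_distrib[of _ n]) (auto intro!: mult_mat_vec_carrier[of _ n m])
  finally show ?case using Cons by simp
qed (simp add: scalar_prod_def)

section \<open>Kraus families\<close>

definition kraus_map :: "nat \<Rightarrow> complex mat list \<Rightarrow> complex mat \<Rightarrow> complex mat" where
  "kraus_map n Ks \<rho> = mat_sum n n (map (\<lambda>K. K * \<rho> * mat_adjoint K) Ks)"

text \<open>
  The entries of the Choi matrix. They determine the operation and, unlike the list of Kraus
  operators, do not depend on the chosen representation.
\<close>

definition kraus_kernel :: "complex mat list \<Rightarrow> nat \<Rightarrow> nat \<Rightarrow> nat \<Rightarrow> nat \<Rightarrow> complex" where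
  "kraus_kernel Ks x u y v = (\<Sum>K\<leftarrow>Ks. K $$ (x, u) * cnj (K $$ (y, v)))"

text \<open>Equality of Choi matrices. The carrier conditions belong to it because only entries
  within the stated sizes are meaningful.\<close>

definition same_kernel :: "nat \<Rightarrow> nat \<Rightarrow> complex mat list \<Rightarrow> complex mat list \<Rightarrow> bool" where
  "same_kernel r c F G \<longleftrightarrow> set F \<subseteq> carrier_mat r c \<and> set G \<subseteq> carrier_mat r c \<and>
     (\<forall>x<r. \<forall>y<r. \<forall>u<c. \<forall>v<c. kraus_kernel F x u y v = kraus_kernel G x u y v)"

text \<open>The sum over \<open>x\<close> is the entry \<open>(v, u)\<close> of the sum of all
  \<open>mat_adjoint K * K\<close>, so this is the usual condition that these products add up to the
  identity, phrased through the kernel so that it factorises over tensor products.\<close>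

definition trace_preserving :: "nat \<Rightarrow> nat \<Rightarrow> complex mat list \<Rightarrow> bool" where
  "trace_preserving r c F \<longleftrightarrow> set F \<subseteq> carrier_mat r c \<and>
     (\<forall>u<c. \<forall>v<c. (\<Sum>x<r. kraus_kernel F x u x v) = (if u = v then 1 else 0))"

text \<open>Serves both for composition (\<open>h\<close> is matrix multiplication) and for tensor
  products (\<open>h\<close> is \<open>kron\<close>). The order, with \<open>xs\<close> outermost,
  is the one in which \<open>product_lists\<close> unfolds.\<close>

definition pairwise :: "('a \<Rightarrow> 'b \<Rightarrow> 'c) \<Rightarrow> 'a list \<Rightarrow> 'b list \<Rightarrow> 'c list" where
  "pairwise h xs ys = concat (map (\<lambda>x. map (h x) ys) xs)"

lemma set_pairwise: "set (pairwise h xs ys) = {h x y |x y. x \<in> set xs \<and> y \<in> set ys}"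
  by (auto simp: pairwise_def)

lemma sum_list_pairwise:
  "sum_list (map f (pairwise h xs ys)) = (\<Sum>x\<leftarrow>xs. \<Sum>y\<leftarrow>ys. f (h x y))"
  by (induction xs) (auto simp: pairwise_def o_def)

lemma sum_list_swap:
  "(\<Sum>x\<leftarrow>xs. \<Sum>y\<leftarrow>ys. f x y) = (\<Sum>y\<leftarrow>ys. \<Sum>x\<leftarrow>xs. (f x y :: 'a :: comm_monoid_add))"
  by (induction xs) (auto simp: sum_list_addf)

lemma sum_sum_list_swap:
  "(\<Sum>x\<leftarrow>xs. \<Sum>y\<in>Y. f x y) = (\<Sum>y\<in>Y. \<Sum>x\<leftarrow>xs. (f x y :: 'a :: comm_monoid_add))"
  by (induction xs) (auto simp: sum.distrib)

lemma sum_list_cong: "(\<And>x. x \<in> set xs \<Longrightarrow> f x = g x) \<Longrightarrow> (\<Sum>x\<leftarrow>xs. f x) = (\<Sum>x\<leftarrow>xs. g x)"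
  by (metis map_cong)

lemma dim_kraus_map [simp]:
  "dim_row (kraus_map r F \<rho>) = r" "dim_col (kraus_map r F \<rho>) = r"
  by (auto simp: kraus_map_def)

lemma sandwich_carrier:
  "K \<in> carrier_mat r c \<Longrightarrow> \<rho> \<in> carrier_mat c c \<Longrightarrow> K * \<rho> * mat_adjoint K \<in> carrier_mat r r"
  by (intro mult_carrier_mat[of _ r c _ r] mult_carrier_mat[of _ r c _ c]) auto

lemma kraus_map_carrier [simp]:
  "kraus_map r F \<rho> \<in> carrier_mat r r"
  by (simp add: kraus_map_def)

lemma index_triple_mult:
  fixes A B C :: "complex mat"
  assumes "A \<in> carrier_mat n m" "B \<in> carrier_mat m k" "C \<in> carrier_mat k l" "x < n" "y < l"
  shows "(A * B * C) $$ (x, y) = (\<Sum>u<m. \<Sum>v<k. A $$ (x, u) * B $$ (u, v) * C $$ (v, y))"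
proof -
  have "(A * B * C) $$ (x, y) = (\<Sum>v<k. \<Sum>u<m. A $$ (x, u) * B $$ (u, v) * C $$ (v, y))"
    using assms by (simp add: scalar_prod_def sum_distrib_right lessThan_atLeast0 del: assoc_mult_mat)
  also have "\<dots> = (\<Sum>u<m. \<Sum>v<k. A $$ (x, u) * B $$ (u, v) * C $$ (v, y))"
    by (rule sum.swap)
  finally show ?thesis .
qed

text \<open>Each output entry is linear in the entries of \<open>\<rho>\<close>, with the kernel as
  coefficients; this is why the kernel alone determines the operation.\<close>

lemma index_kraus_map:
  assumes F: "set F \<subseteq> carrier_mat r c" and \<rho>: "\<rho> \<in> carrier_mat c c" and x: "x < r" "y < r"
  shows "kraus_map r F \<rho> $$ (x, y) = (\<Sum>u<c. \<Sum>v<c. kraus_kernel F x u y v * \<rho> $$ (u, v))"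
proof -
  have "kraus_map r F \<rho> $$ (x, y) = (\<Sum>K\<leftarrow>F. (K * \<rho> * mat_adjoint K) $$ (x, y))"
    unfolding kraus_map_def using F \<rho> x
    by (subst index_mat_sum) (auto simp: o_def intro!: sandwich_carrier)
  also have "\<dots> = (\<Sum>K\<leftarrow>F. \<Sum>u<c. \<Sum>v<c. K $$ (x, u) * cnj (K $$ (y, v)) * \<rho> $$ (u, v))"
  proof (rule sum_list_cong)
    fix K assume "K \<in> set F"
    then have "K \<in> carrier_mat r c" using F by auto
    then show "(K * \<rho> * mat_adjoint K) $$ (x, y)
        = (\<Sum>u<c. \<Sum>v<c. K $$ (x, u) * cnj (K $$ (y, v)) * \<rho> $$ (u, v))"
      using \<rho> x by (subst index_triple_mult[of _ r c _ c _ r]) (auto intro!: sum.cong)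
  qed
  also have "\<dots> = (\<Sum>u<c. \<Sum>v<c. kraus_kernel F x u y v * \<rho> $$ (u, v))"
    by (simp add: sum_sum_list_swap kraus_kernel_def sum_list_mult_const)
  finally show ?thesis .
qed

lemma kraus_map_same_kernel:
  assumes "same_kernel r c F G" "\<rho> \<in> carrier_mat c c"
  shows "kraus_map r F \<rho> = kraus_map r G \<rho>"
proof -
  have "set F \<subseteq> carrier_mat r c" "set G \<subseteq> carrier_mat r c"
    using assms by (auto simp: same_kernel_def)
  then show ?thesis
    using assms by (intro eq_matI) (auto simp: index_kraus_map same_kernel_def intro!: sum.cong)
qed

lemma same_kernel_refl: "set F \<subseteq> carrier_mat r c \<Longrightarrow> same_kernel r c F F"
  by (auto simp: same_kernel_def)

lemma same_kernel_trans: "same_kernel r c F G \<Longrightarrow> same_kernel r c G H \<Longrightarrow> same_kernel r c F H"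
  by (auto simp: same_kernel_def)

text \<open>Moving the sum over the diagonal index \<open>x\<close> innermost turns the kernel into
  a Kronecker delta, which picks out the diagonal of \<open>\<rho>\<close>.\<close>

lemma mat_trace_kraus_map:
  assumes "trace_preserving r c F" and \<rho>: "\<rho> \<in> carrier_mat c c"
  shows "mat_trace (kraus_map r F \<rho>) = mat_trace \<rho>"
proof -
  have F: "set F \<subseteq> carrier_mat r c" using assms by (auto simp: trace_preserving_def)
  have "mat_trace (kraus_map r F \<rho>) = (\<Sum>x<r. \<Sum>u<c. \<Sum>v<c. kraus_kernel F x u x v * \<rho> $$ (u, v))"
    using F \<rho> by (subst mat_trace_eq_sum[of _ r]) (auto simp: index_kraus_map)
  also have "\<dots> = (\<Sum>u<c. \<Sum>x<r. \<Sum>v<c. kraus_kernel F x u x v * \<rho> $$ (u, v))"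
    by (rule sum.swap)
  also have "\<dots> = (\<Sum>u<c. \<Sum>v<c. \<Sum>x<r. kraus_kernel F x u x v * \<rho> $$ (u, v))"
    by (intro sum.cong refl sum.swap)
  also have "\<dots> = (\<Sum>u<c. \<Sum>v<c. (if u = v then 1 else 0) * \<rho> $$ (u, v))"
    using assms by (intro sum.cong refl) (simp add: trace_preserving_def flip: sum_distrib_right)
  also have "\<dots> = mat_trace \<rho>"
    using \<rho> by (subst mat_trace_eq_sum[of _ c]) (auto simp: if_distrib if_distribR cong: if_cong)
  finally show ?thesis .
qed

text \<open>Positivity holds operator by operator: the quadratic form of
  \<open>K * \<rho> * mat_adjoint K\<close> at \<open>v\<close> is that of \<open>\<rho>\<close> at
  \<open>mat_adjoint K *\<^sub>v v\<close>.\<close>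

lemma density_operator_kraus_map:
  assumes tp: "trace_preserving r c F" and \<rho>: "density_operator c \<rho>"
  shows "density_operator r (kraus_map r F \<rho>)"
proof -
  have F: "K \<in> carrier_mat r c" if "K \<in> set F" for K
    using tp that by (auto simp: trace_preserving_def)
  have \<rho>c: "\<rho> \<in> carrier_mat c c" using \<rho> by (auto simp: density_operator_def)
  have KK: "set (map (\<lambda>K. K * \<rho> * mat_adjoint K) F) \<subseteq> carrier_mat r r"
    using F \<rho>c by (auto intro!: sandwich_carrier)
  have "mat_adjoint (kraus_map r F \<rho>) = kraus_map r F \<rho>"
  proof -
    have "mat_adjoint (K * \<rho> * mat_adjoint K) = K * \<rho> * mat_adjoint K" if "K \<in> set F" for K
    proof -
      have "mat_adjoint (K * \<rho> * mat_adjoint K) = K * (mat_adjoint \<rho> * mat_adjoint K)"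
        using F[OF that] \<rho>c by (simp add: mat_adjoint_mult[of _ r c] mat_adjoint_mult[of _ r c _ r])
      also have "\<dots> = K * \<rho> * mat_adjoint K"
        using F[OF that] \<rho> by (simp add: density_operator_def assoc_mult_mat[of _ r c _ c _ r])
      finally show ?thesis .
    qed
    then have eq: "map mat_adjoint (map (\<lambda>K. K * \<rho> * mat_adjoint K) F) = map (\<lambda>K. K * \<rho> * mat_adjoint K) F"
      by simp
    show ?thesis
      by (simp only: kraus_map_def mat_adjoint_mat_sum[OF KK] eq)
  qed
  moreover have "0 \<le> Re ((kraus_map r F \<rho> *\<^sub>v v) \<bullet>c v)" if v: "v \<in> carrier_vec r" for v
  proof -
    have "(kraus_map r F \<rho> *\<^sub>v v) \<bullet>c v = (\<Sum>K\<leftarrow>F. ((K * \<rho> * mat_adjoint K) *\<^sub>v v) \<bullet>c v)"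
      unfolding kraus_map_def using mat_sum_mult_vec[OF KK v v] by (simp add: o_def)
    also have "\<dots> = (\<Sum>K\<leftarrow>F. (\<rho> *\<^sub>v (mat_adjoint K *\<^sub>v v)) \<bullet>c (mat_adjoint K *\<^sub>v v))"
    proof (rule sum_list_cong)
      fix K assume "K \<in> set F"
      then have K: "K \<in> carrier_mat r c" by (rule F)
      have "(K * \<rho> * mat_adjoint K) *\<^sub>v v = K *\<^sub>v (\<rho> *\<^sub>v (mat_adjoint K *\<^sub>v v))"
        using K \<rho>c v
        by (simp add: assoc_mult_mat_vec[of _ r c _ r] assoc_mult_mat_vec[of _ r c _ c] mult_mat_vec_carrier[of _ c r])
      then show "((K * \<rho> * mat_adjoint K) *\<^sub>v v) \<bullet>c v = (\<rho> *\<^sub>v (mat_adjoint K *\<^sub>v v)) \<bullet>c (mat_adjoint K *\<^sub>v v)"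
        using K \<rho>c v
        by (simp add: cscalar_prod_adjoint[OF K] mult_mat_vec_carrier[of _ c r] mult_mat_vec_carrier[of _ c c])
    qed
    also have "Re \<dots> = (\<Sum>K\<leftarrow>F. Re ((\<rho> *\<^sub>v (mat_adjoint K *\<^sub>v v)) \<bullet>c (mat_adjoint K *\<^sub>v v)))"
      by (induction F) auto
    also have "\<dots> \<ge> 0"
    proof (rule sum_list_nonneg)
      fix z assume "z \<in> set (map (\<lambda>K. Re ((\<rho> *\<^sub>v (mat_adjoint K *\<^sub>v v)) \<bullet>c (mat_adjoint K *\<^sub>v v))) F)"
      then obtain K where K: "K \<in> set F" "z = Re ((\<rho> *\<^sub>v (mat_adjoint K *\<^sub>v v)) \<bullet>c (mat_adjoint K *\<^sub>v v))"
        by auto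
      have "mat_adjoint K *\<^sub>v v \<in> carrier_vec c"
        using F[OF K(1)] v by (auto intro!: mult_mat_vec_carrier)
      then show "0 \<le> z" using K \<rho> by (auto simp: density_operator_def)
    qed
    finally show ?thesis .
  qed
  ultimately show ?thesis
    using mat_trace_kraus_map[OF tp \<rho>c] \<rho> KK
    by (auto simp: density_operator_def kraus_map_def simp del: set_map)
qed

text \<open>Kernels compose by contracting the two intermediate indices, \<open>s\<close> for the
  operator and \<open>t\<close> for its conjugate. Hence the kernel of a composite depends only on
  the kernels of its parts.\<close>

lemma kraus_kernel_mult:
  assumes "set F \<subseteq> carrier_mat r m" "set G \<subseteq> carrier_mat m c" "x < r" "y < r" "u < c" "v < c"
  shows "kraus_kernel (pairwise (*) F G) x u y v =
    (\<Sum>s<m. \<Sum>t<m. kraus_kernel F x s y t * kraus_kernel G s u t v)"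
proof -
  have "kraus_kernel (pairwise (*) F G) x u y v =
      (\<Sum>A\<leftarrow>F. \<Sum>B\<leftarrow>G. (A * B) $$ (x, u) * cnj ((A * B) $$ (y, v)))"
    by (simp add: kraus_kernel_def sum_list_pairwise)
  also have "\<dots> = (\<Sum>A\<leftarrow>F. \<Sum>B\<leftarrow>G. \<Sum>s<m. \<Sum>t<m.
      (A $$ (x, s) * cnj (A $$ (y, t))) * (B $$ (s, u) * cnj (B $$ (t, v))))"
  proof (intro sum_list_cong)
    fix A B assume "A \<in> set F" "B \<in> set G"
    then have "A \<in> carrier_mat r m" "B \<in> carrier_mat m c" using assms by auto
    then show "(A * B) $$ (x, u) * cnj ((A * B) $$ (y, v)) = (\<Sum>s<m. \<Sum>t<m.
      (A $$ (x, s) * cnj (A $$ (y, t))) * (B $$ (s, u) * cnj (B $$ (t, v))))"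
      using assms by (simp add: scalar_prod_def lessThan_atLeast0 sum_product ac_simps)
  qed
  also have "\<dots> = (\<Sum>s<m. \<Sum>t<m. \<Sum>A\<leftarrow>F. \<Sum>B\<leftarrow>G.
      (A $$ (x, s) * cnj (A $$ (y, t))) * (B $$ (s, u) * cnj (B $$ (t, v))))"
    by (simp add: sum_sum_list_swap)
  also have "\<dots> = (\<Sum>s<m. \<Sum>t<m. kraus_kernel F x s y t * kraus_kernel G s u t v)"
    by (simp add: kraus_kernel_def sum_list_const_mult sum_list_mult_const)
  finally show ?thesis .
qed

lemma kraus_map_comp:
  assumes F: "set F \<subseteq> carrier_mat r m" and G: "set G \<subseteq> carrier_mat m c" and \<rho>: "\<rho> \<in> carrier_mat c c"
  shows "kraus_map r F (kraus_map m G \<rho>) = kraus_map r (pairwise (*) F G) \<rho>"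
proof -
  have FG: "set (pairwise (*) F G) \<subseteq> carrier_mat r c" using F G by (fastforce simp: set_pairwise)
  have c: "kraus_map m G \<rho> \<in> carrier_mat m m" using G \<rho> by simp
  have c2: "kraus_map r F (kraus_map m G \<rho>) \<in> carrier_mat r r"
       "kraus_map r (pairwise (*) F G) \<rho> \<in> carrier_mat r r" using F FG c \<rho> by auto
  show ?thesis
  proof (rule eq_matI)
    fix x y assume "x < dim_row (kraus_map r (pairwise (*) F G) \<rho>)"
      "y < dim_col (kraus_map r (pairwise (*) F G) \<rho>)"
    then have xy: "x < r" "y < r" using c2 by auto
    have "kraus_map r F (kraus_map m G \<rho>) $$ (x, y) =
      (\<Sum>s<m. \<Sum>t<m. \<Sum>u<c. \<Sum>v<c. kraus_kernel F x s y t * kraus_kernel G s u t v * \<rho> $$ (u, v))"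
      using F G \<rho> xy c by (simp add: index_kraus_map[of _ r m] index_kraus_map[of _ m c] sum_distrib_left ac_simps)
    also have "\<dots> = (\<Sum>u<c. \<Sum>v<c. \<Sum>s<m. \<Sum>t<m. kraus_kernel F x s y t * kraus_kernel G s u t v * \<rho> $$ (u, v))"
      by (simp add: sum.swap[of _ "{..<c}" "{..<m}"])
    also have "\<dots> = kraus_map r (pairwise (*) F G) \<rho> $$ (x, y)"
      using F G FG \<rho> xy
      by (simp add: index_kraus_map[of _ r c] kraus_kernel_mult[of _ r m _ c] sum_distrib_right)
    finally show "kraus_map r F (kraus_map m G \<rho>) $$ (x, y) = kraus_map r (pairwise (*) F G) \<rho> $$ (x, y)" .
  qed (use c2 in auto)
qed

section \<open>Tensor products\<close>

lemma dim_kron [simp]: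
  "dim_row (kron A B) = dim_row A * dim_row B" "dim_col (kron A B) = dim_col A * dim_col B"
  by (auto simp: kron_def)

lemma kron_carrier:
  "A \<in> carrier_mat r c \<Longrightarrow> B \<in> carrier_mat r' c' \<Longrightarrow> kron A B \<in> carrier_mat (r * r') (c * c')"
  by (intro carrier_matI) auto

lemma index_kron:
  "i < dim_row A * dim_row B \<Longrightarrow> j < dim_col A * dim_col B \<Longrightarrow>
   kron A B $$ (i, j) = A $$ (i div dim_row B, j div dim_col B) * B $$ (i mod dim_row B, j mod dim_col B)"
  by (simp add: kron_def)

lemma div_mod_less_factors:
  fixes i :: nat
  assumes "i < m * n"
  shows "i div n < m" "i mod n < n"
proof -
  have "n > 0" using assms by (cases n) auto
  then show "i div n < m" "i mod n < n" using assms by (auto simp: less_mult_imp_div_less)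
qed

text \<open>\<open>kron\<close> encodes a pair of indices as quotient and remainder by the inner
  size; grouping the range into blocks of length \<open>n\<close> undoes this encoding.\<close>

lemma sum_div_mod:
  fixes f :: "nat \<Rightarrow> nat \<Rightarrow> 'a :: comm_monoid_add"
  shows "(\<Sum>k<m * n. f (k div n) (k mod n)) = (\<Sum>a<m. \<Sum>b<n. f a b)"
proof -
  have "(\<Sum>k<m * n. f (k div n) (k mod n)) = (\<Sum>a<m. \<Sum>k\<in>{a * n..<a * n + n}. f (k div n) (k mod n))"
    by (simp add: sum.nat_group)
  also have "\<dots> = (\<Sum>a<m. \<Sum>b<n. f a b)"
  proof (rule sum.cong[OF refl])
    fix a
    have "(\<Sum>k\<in>{a * n..<a * n + n}. f (k div n) (k mod n)) = (\<Sum>b<n. f ((b + a * n) div n) ((b + a * n) mod n))"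
      using sum.shift_bounds_nat_ivl[of "\<lambda>k. f (k div n) (k mod n)" 0 "a * n" n]
      by (simp add: lessThan_atLeast0 add.commute)
    then show "(\<Sum>k\<in>{a * n..<a * n + n}. f (k div n) (k mod n)) = (\<Sum>b<n. f a b)"
      by simp
  qed
  finally show ?thesis .
qed

text \<open>The mixed-product rule: the contracted index splits into quotient and remainder, so the
  sum over it is a product of two sums.\<close>

lemma kron_mult:
  assumes A: "A \<in> carrier_mat r m" "C \<in> carrier_mat m c" and B: "B \<in> carrier_mat r' m'" "D \<in> carrier_mat m' c'"
  shows "kron A B * kron C D = kron (A * C) (B * D)"
proof (rule eq_matI)
  fix i j assume "i < dim_row (kron (A * C) (B * D))" "j < dim_col (kron (A * C) (B * D))"
  then have ij: "i < r * r'" "j < c * c'" using assms by auto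
  note d = div_mod_less_factors[OF ij(1)] div_mod_less_factors[OF ij(2)]
  have "(kron A B * kron C D) $$ (i, j) = (\<Sum>k<m * m'. (A $$ (i div r', k div m') * B $$ (i mod r', k mod m')) *
          (C $$ (k div m', j div c') * D $$ (k mod m', j mod c')))"
    using assms ij d by (auto simp: scalar_prod_def index_kron lessThan_atLeast0 intro!: sum.cong)
  also have "\<dots> = (\<Sum>a<m. \<Sum>b<m'. (A $$ (i div r', a) * B $$ (i mod r', b)) * (C $$ (a, j div c') * D $$ (b, j mod c')))"
    by (rule sum_div_mod)
  also have "\<dots> = kron (A * C) (B * D) $$ (i, j)"
    using assms ij d
    by (simp add: index_kron scalar_prod_def lessThan_atLeast0 sum_product ac_simps del: assoc_mult_mat)
  finally show "(kron A B * kron C D) $$ (i, j) = kron (A * C) (B * D) $$ (i, j)" .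
qed (use assms in auto)

lemma kron_adjoint: "mat_adjoint (kron A B) = kron (mat_adjoint A) (mat_adjoint B)"
proof (rule eq_matI)
  fix i j assume "i < dim_row (kron (mat_adjoint A) (mat_adjoint B))" "j < dim_col (kron (mat_adjoint A) (mat_adjoint B))"
  then have ij: "i < dim_col A * dim_col B" "j < dim_row A * dim_row B" by auto
  then show "mat_adjoint (kron A B) $$ (i, j) = kron (mat_adjoint A) (mat_adjoint B) $$ (i, j)"
    using div_mod_less_factors[OF ij(1)] div_mod_less_factors[OF ij(2)] by (simp add: index_kron)
qed auto

lemma kron_one: "kron (1\<^sub>m m) (1\<^sub>m n) = 1\<^sub>m (m * n)"
proof (rule eq_matI)
  fix i j assume "i < dim_row (1\<^sub>m (m * n) :: complex mat)" "j < dim_col (1\<^sub>m (m * n) :: complex mat)"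
  then have ij: "i < m * n" "j < m * n" by auto
  have "i = j" if "i div n = j div n" "i mod n = j mod n" using that by (metis div_mult_mod_eq)
  then show "kron (1\<^sub>m m) (1\<^sub>m n) $$ (i, j) = (1\<^sub>m (m * n) :: complex mat) $$ (i, j)"
    using ij div_mod_less_factors[OF ij(1)] div_mod_less_factors[OF ij(2)] by (auto simp: index_kron)
qed auto

lemma kron_one_one [simp]: "kron (1\<^sub>m (Suc 0)) A = A" "kron A (1\<^sub>m (Suc 0)) = A"
  by (auto intro!: eq_matI simp: index_kron)

lemma kron_assoc: "kron (kron A B) C = kron A (kron B C)"
proof (rule eq_matI)
  fix i j assume "i < dim_row (kron A (kron B C))" "j < dim_col (kron A (kron B C))"
  then have i: "i < (dim_row A * dim_row B) * dim_row C" and j: "j < (dim_col A * dim_col B) * dim_col C"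
    by (auto simp: mult.assoc)
  \<comment> \<open>Mixed-radix digits: splitting by \<open>b * c\<close> first and by
    \<open>c\<close> first yield the same three digits. Division by zero has default values, whence
    the separate case \<open>c = 0\<close>.\<close>
  have mod: "x mod (b * c) div c = x div c mod b" "x mod (b * c) mod c = x mod c" "x div (b * c) = x div c div b" for x b c :: nat
    by (cases "c = 0"; simp add: mult.commute[of b c] mod_mult2_eq div_mult2_eq)+
  note d = div_mod_less_factors[OF i] div_mod_less_factors[OF j]
  note e = div_mod_less_factors[OF i[unfolded mult.assoc]] div_mod_less_factors[OF j[unfolded mult.assoc]]
  show "kron (kron A B) C $$ (i, j) = kron A (kron B C) $$ (i, j)"
    using i j d e by (simp add: index_kron mod mult.assoc)
qed (auto simp: mult.assoc)

lemma tensor_simps [simp]: "tensor [] = 1\<^sub>m 1" "tensor (A # As) = kron A (tensor As)"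
  by (auto simp: tensor_def)

lemma dim_tensor [simp]:
  "dim_row (tensor As) = prod_list (map dim_row As)" "dim_col (tensor As) = prod_list (map dim_col As)"
  by (induction As) auto

lemma tensor_one: "tensor (map 1\<^sub>m ds) = 1\<^sub>m (prod_list ds)"
  by (induction ds) (auto simp: kron_one)

lemma tensor_adjoint: "mat_adjoint (tensor As) = tensor (map mat_adjoint As)"
  by (induction As) (auto simp: kron_adjoint)

section \<open>Operations that act factorwise\<close>

text \<open>Kraus operators of the tensor product of the operations with Kraus families
  \<open>Fs\<close>. Measurements and partial traces are both of this form.\<close>

definition tensor_family :: "complex mat list list \<Rightarrow> complex mat list" where
  "tensor_family Fs = map tensor (product_lists Fs)"

lemma tensor_family_simps [simp]:
  "tensor_family [] = [1\<^sub>m 1]"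
  "tensor_family (F # Fs) = pairwise kron F (tensor_family Fs)"
  by (auto simp: tensor_family_def pairwise_def map_concat o_def)

lemma pairwise_kron_carrier:
  assumes "set F \<subseteq> carrier_mat r c" "set G \<subseteq> carrier_mat r' c'"
  shows "set (pairwise kron F G) \<subseteq> carrier_mat (r * r') (c * c')"
  using assms by (auto simp: set_pairwise intro!: kron_carrier)

text \<open>Quotients address the first factor and remainders the second, in all four indices at
  once. This factorisation reduces every comparison on the composite system to the single
  factors.\<close>

lemma kraus_kernel_kron:
  assumes F: "set F \<subseteq> carrier_mat r c" and G: "set G \<subseteq> carrier_mat r' c'"
    and "x < r * r'" "y < r * r'" "u < c * c'" "v < c * c'"
  shows "kraus_kernel (pairwise kron F G) x u y v =
    kraus_kernel F (x div r') (u div c') (y div r') (v div c') *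
    kraus_kernel G (x mod r') (u mod c') (y mod r') (v mod c')"
proof -
  have "kraus_kernel (pairwise kron F G) x u y v =
      (\<Sum>A\<leftarrow>F. \<Sum>B\<leftarrow>G. kron A B $$ (x, u) * cnj (kron A B $$ (y, v)))"
    by (simp add: kraus_kernel_def sum_list_pairwise)
  also have "\<dots> = (\<Sum>A\<leftarrow>F. \<Sum>B\<leftarrow>G.
      (A $$ (x div r', u div c') * cnj (A $$ (y div r', v div c'))) *
      (B $$ (x mod r', u mod c') * cnj (B $$ (y mod r', v mod c'))))"
  proof (intro sum_list_cong)
    fix A B assume "A \<in> set F" "B \<in> set G"
    then have "A \<in> carrier_mat r c" "B \<in> carrier_mat r' c'" using F G by auto
    then show "kron A B $$ (x, u) * cnj (kron A B $$ (y, v)) =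
      (A $$ (x div r', u div c') * cnj (A $$ (y div r', v div c'))) *
      (B $$ (x mod r', u mod c') * cnj (B $$ (y mod r', v mod c')))"
      using assms by (simp add: index_kron)
  qed
  also have "\<dots> = kraus_kernel F (x div r') (u div c') (y div r') (v div c') *
    kraus_kernel G (x mod r') (u mod c') (y mod r') (v mod c')"
    by (simp add: kraus_kernel_def sum_list_const_mult sum_list_mult_const)
  finally show ?thesis .
qed

lemma same_kernel_kron:
  assumes "same_kernel r c F F'" "same_kernel r' c' G G'"
  shows "same_kernel (r * r') (c * c') (pairwise kron F G) (pairwise kron F' G')"
  using assms pairwise_kron_carrier[of F r c G r' c'] pairwise_kron_carrier[of F' r c G' r' c']
  unfolding same_kernel_def by (simp add: kraus_kernel_kron[of _ r c _ r' c'] div_mod_less_factors)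

lemma trace_preserving_kron:
  assumes F: "trace_preserving r c F" and G: "trace_preserving r' c' G"
  shows "trace_preserving (r * r') (c * c') (pairwise kron F G)"
  unfolding trace_preserving_def
proof (intro conjI allI impI)
  note car = F[unfolded trace_preserving_def, THEN conjunct1] G[unfolded trace_preserving_def, THEN conjunct1]
  show "set (pairwise kron F G) \<subseteq> carrier_mat (r * r') (c * c')"
    using car by (rule pairwise_kron_carrier)
  fix u v assume uv: "u < c * c'" "v < c * c'"
  note d = div_mod_less_factors[OF uv(1)] div_mod_less_factors[OF uv(2)]
  have "(\<Sum>x<r * r'. kraus_kernel (pairwise kron F G) x u x v) =
      (\<Sum>x<r * r'. kraus_kernel F (x div r') (u div c') (x div r') (v div c') *
        kraus_kernel G (x mod r') (u mod c') (x mod r') (v mod c'))"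
    using uv by (simp add: kraus_kernel_kron[OF car])
  also have "\<dots> = (\<Sum>a<r. \<Sum>b<r'. kraus_kernel F a (u div c') a (v div c') *
        kraus_kernel G b (u mod c') b (v mod c'))"
    by (rule sum_div_mod)
  also have "\<dots> = (\<Sum>a<r. kraus_kernel F a (u div c') a (v div c')) * (\<Sum>b<r'. kraus_kernel G b (u mod c') b (v mod c'))"
    by (simp add: sum_product)
  also have "\<dots> = (if u div c' = v div c' then 1 else 0) * (if u mod c' = v mod c' then 1 else 0)"
    using F G d by (simp add: trace_preserving_def)
  also have "\<dots> = (if u = v then 1 else 0)"
    by (auto, metis div_mult_mod_eq)
  finally show "(\<Sum>x<r * r'. kraus_kernel (pairwise kron F G) x u x v) = (if u = v then 1 else 0)" .
qed

text \<open>By the mixed-product rule both lists contain the same matrices, but the left one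
  enumerates \<open>A, B, A', B'\<close> and the right one \<open>A, A', B, B'\<close>. The lists
  differ, while sums over them agree.\<close>

lemma same_kernel_mult_kron:
  assumes F: "set F \<subseteq> carrier_mat r m" "set F' \<subseteq> carrier_mat m c"
    and G: "set G \<subseteq> carrier_mat r' m'" "set G' \<subseteq> carrier_mat m' c'"
  shows "same_kernel (r * r') (c * c') (pairwise (*) (pairwise kron F G) (pairwise kron F' G'))
    (pairwise kron (pairwise (*) F F') (pairwise (*) G G'))"
proof -
  \<comment> \<open>An arbitrary summand \<open>f\<close> covers the kernel at all index quadruples
    simultaneously.\<close>
  have sums: "(\<Sum>K\<leftarrow>pairwise (*) (pairwise kron F G) (pairwise kron F' G'). f K) =
      (\<Sum>K\<leftarrow>pairwise kron (pairwise (*) F F') (pairwise (*) G G'). f K)" for f :: "complex mat \<Rightarrow> complex"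
  proof -
    have "(\<Sum>K\<leftarrow>pairwise (*) (pairwise kron F G) (pairwise kron F' G'). f K) =
        (\<Sum>A\<leftarrow>F. \<Sum>B\<leftarrow>G. \<Sum>A'\<leftarrow>F'. \<Sum>B'\<leftarrow>G'. f (kron A B * kron A' B'))"
      by (simp add: sum_list_pairwise)
    also have "\<dots> = (\<Sum>A\<leftarrow>F. \<Sum>B\<leftarrow>G. \<Sum>A'\<leftarrow>F'. \<Sum>B'\<leftarrow>G'. f (kron (A * A') (B * B')))"
    proof (intro sum_list_cong)
      fix A B A' B' assume "A \<in> set F" "B \<in> set G" "A' \<in> set F'" "B' \<in> set G'"
      then have "kron A B * kron A' B' = kron (A * A') (B * B')"
        using assms by (intro kron_mult[of A r m A' c B r' m' B' c']) auto
      then show "f (kron A B * kron A' B') = f (kron (A * A') (B * B'))" by simp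
    qed
    also have "\<dots> = (\<Sum>A\<leftarrow>F. \<Sum>A'\<leftarrow>F'. \<Sum>B\<leftarrow>G. \<Sum>B'\<leftarrow>G'. f (kron (A * A') (B * B')))"
      by (intro sum_list_cong sum_list_swap)
    finally show ?thesis by (simp add: sum_list_pairwise)
  qed
  have "set (pairwise (*) F F') \<subseteq> carrier_mat r c" "set (pairwise (*) G G') \<subseteq> carrier_mat r' c'"
    using assms by (fastforce simp: set_pairwise)+
  then have "set (pairwise kron (pairwise (*) F F') (pairwise (*) G G')) \<subseteq> carrier_mat (r * r') (c * c')"
    by (rule pairwise_kron_carrier)
  moreover have "set (pairwise (*) (pairwise kron F G) (pairwise kron F' G')) \<subseteq> carrier_mat (r * r') (c * c')"
    using pairwise_kron_carrier[OF F(1) G(1)] pairwise_kron_carrier[OF F(2) G(2)]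
    unfolding set_pairwise[of "(*)"] by (blast intro: mult_carrier_mat)
  ultimately show ?thesis
    by (simp add: same_kernel_def kraus_kernel_def sums)
qed

lemma tensor_family_carrier:
  assumes "\<And>k. k \<in> set ks \<Longrightarrow> set (F k) \<subseteq> carrier_mat (r k) (c k)"
  shows "set (tensor_family (map F ks)) \<subseteq> carrier_mat (prod_list (map r ks)) (prod_list (map c ks))"
  using assms
proof (induction ks)
  case (Cons k ks)
  then have "set (pairwise kron (F k) (tensor_family (map F ks))) \<subseteq>
      carrier_mat (r k * prod_list (map r ks)) (c k * prod_list (map c ks))"
    by (intro pairwise_kron_carrier) auto
  then show ?case by simp
qed auto

lemma trace_preserving_tensor_family:
  assumes "\<And>k. k \<in> set ks \<Longrightarrow> trace_preserving (r k) (c k) (F k)"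
  shows "trace_preserving (prod_list (map r ks)) (prod_list (map c ks)) (tensor_family (map F ks))"
  using assms
proof (induction ks)
  case Nil
  show ?case by (simp add: trace_preserving_def kraus_kernel_def)
next
  case (Cons k ks)
  then show ?case using trace_preserving_kron[of "r k" "c k" "F k"] by simp
qed

lemma same_kernel_tensor_family:
  assumes "\<And>k. k \<in> set ks \<Longrightarrow> same_kernel (r k) (c k) (F k) (G k)"
  shows "same_kernel (prod_list (map r ks)) (prod_list (map c ks)) (tensor_family (map F ks)) (tensor_family (map G ks))"
  using assms
proof (induction ks)
  case Nil
  show ?case by (simp add: same_kernel_refl)
next
  case (Cons k ks)
  then show ?case using same_kernel_kron[of "r k" "c k" "F k" "G k"] by simp
qed

text \<open>The induction step first regroups the head factor against the tail and then replaces the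
  tail by the induction hypothesis; transitivity of \<open>same_kernel\<close> joins the
  two.\<close>

lemma same_kernel_mult_tensor_family:
  assumes "\<And>k. k \<in> set ks \<Longrightarrow> set (F k) \<subseteq> carrier_mat (r k) (m k)"
    "\<And>k. k \<in> set ks \<Longrightarrow> set (G k) \<subseteq> carrier_mat (m k) (c k)"
  shows "same_kernel (prod_list (map r ks)) (prod_list (map c ks))
    (pairwise (*) (tensor_family (map F ks)) (tensor_family (map G ks)))
    (tensor_family (map (\<lambda>k. pairwise (*) (F k) (G k)) ks))"
  using assms
proof (induction ks)
  case Nil
  show ?case by (simp add: pairwise_def same_kernel_refl)
next
  case (Cons k ks)
  have F: "set (F k) \<subseteq> carrier_mat (r k) (m k)" and G: "set (G k) \<subseteq> carrier_mat (m k) (c k)"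
    using Cons.prems by auto
  have "set (tensor_family (map F ks)) \<subseteq> carrier_mat (prod_list (map r ks)) (prod_list (map m ks))"
    "set (tensor_family (map G ks)) \<subseteq> carrier_mat (prod_list (map m ks)) (prod_list (map c ks))"
    using Cons.prems by (auto intro!: tensor_family_carrier simp del: subsetI)
  note 1 = same_kernel_mult_kron[OF F G this]
  have "set (pairwise (*) (F k) (G k)) \<subseteq> carrier_mat (r k) (c k)"
    using F G by (fastforce simp: set_pairwise)
  from same_kernel_kron[OF same_kernel_refl[OF this] Cons.IH] Cons.prems
  have "same_kernel (r k * prod_list (map r ks)) (c k * prod_list (map c ks))
     (pairwise kron (pairwise (*) (F k) (G k)) (pairwise (*) (tensor_family (map F ks)) (tensor_family (map G ks))))
     (pairwise kron (pairwise (*) (F k) (G k)) (tensor_family (map (\<lambda>k. pairwise (*) (F k) (G k)) ks)))"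
    by simp
  with 1 show ?case by (auto intro: same_kernel_trans)
qed

text \<open>
  Composing two operations that act factorwise only requires comparing, factor by factor, the
  products of their Kraus operators.
\<close>

lemma kraus_map_tensor_family_comp:
  assumes F: "\<And>k. k \<in> set ks \<Longrightarrow> set (F k) \<subseteq> carrier_mat (r k) (m k)"
    and G: "\<And>k. k \<in> set ks \<Longrightarrow> set (G k) \<subseteq> carrier_mat (m k) (c k)"
    and H: "\<And>k. k \<in> set ks \<Longrightarrow> same_kernel (r k) (c k) (pairwise (*) (F k) (G k)) (H k)"
    and \<rho>: "\<rho> \<in> carrier_mat (prod_list (map c ks)) (prod_list (map c ks))"
  shows "kraus_map (prod_list (map r ks)) (tensor_family (map F ks))
      (kraus_map (prod_list (map m ks)) (tensor_family (map G ks)) \<rho>) =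
    kraus_map (prod_list (map r ks)) (tensor_family (map H ks)) \<rho>"
proof -
  have "kraus_map (prod_list (map r ks)) (tensor_family (map F ks))
      (kraus_map (prod_list (map m ks)) (tensor_family (map G ks)) \<rho>) =
      kraus_map (prod_list (map r ks)) (pairwise (*) (tensor_family (map F ks)) (tensor_family (map G ks))) \<rho>"
    by (rule kraus_map_comp[OF tensor_family_carrier[OF F] tensor_family_carrier[OF G] \<rho>])
  also have "\<dots> = kraus_map (prod_list (map r ks)) (tensor_family (map H ks)) \<rho>"
    using same_kernel_trans[OF same_kernel_mult_tensor_family[OF F G] same_kernel_tensor_family[OF H]] \<rho>
    by (intro kraus_map_same_kernel) auto
  finally show ?thesis .
qed

section \<open>Spectral theorem\<close>

lemma unitary_matI:
  assumes "U \<in> carrier_mat n n" "mat_adjoint U * U = 1\<^sub>m n"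
  shows "unitary_mat n U"
  using assms mat_mult_left_right_inverse[of "mat_adjoint U" n U] by (auto simp: unitary_mat_def)

lemma unitary_carrier: "unitary_mat n U \<Longrightarrow> U \<in> carrier_mat n n"
  by (simp add: unitary_mat_def)

lemma unitary_cancel:
  assumes U: "unitary_mat n U" and X: "X \<in> carrier_mat n m"
  shows "mat_adjoint U * (U * X) = X" "U * (mat_adjoint U * X) = X"
proof -
  have "U \<in> carrier_mat n n" "mat_adjoint U \<in> carrier_mat n n"
    using unitary_carrier[OF U] by auto
  then show "mat_adjoint U * (U * X) = X" "U * (mat_adjoint U * X) = X"
    using U X by (simp_all add: unitary_mat_def flip: assoc_mult_mat[of _ n n _ n _ m])
qed

lemma unitary_mult:
  assumes U: "unitary_mat n U" and V: "unitary_mat n V"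
  shows "unitary_mat n (U * V)"
proof (rule unitary_matI)
  note c = unitary_carrier[OF U] unitary_carrier[OF V]
  show "U * V \<in> carrier_mat n n" using c by simp
  have "mat_adjoint (U * V) * (U * V) = mat_adjoint V * (mat_adjoint U * (U * V))"
    using c by (simp add: mat_adjoint_mult[of _ n n _ n] assoc_mult_mat[of _ n n _ n _ n])
  also have "\<dots> = 1\<^sub>m n"
    using unitary_cancel[OF U c(2)] V by (simp add: unitary_mat_def)
  finally show "mat_adjoint (U * V) * (U * V) = 1\<^sub>m n" .
qed

lemma unitary_mat_of_orthonormal_basis:
  assumes "orthonormal_basis n bs"
  shows "unitary_mat n (mat_of_cols n bs)"
proof (rule unitary_matI)
  have len: "length bs = n" and bs: "\<And>j. j < n \<Longrightarrow> bs ! j \<in> carrier_vec n"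
    and orth: "\<And>j k. j < n \<Longrightarrow> k < n \<Longrightarrow> bs ! j \<bullet>c bs ! k = (if j = k then 1 else 0)"
    using assms by (auto simp: orthonormal_basis_def)
  show c: "mat_of_cols n bs \<in> carrier_mat n n" using len by auto
  show "mat_adjoint (mat_of_cols n bs) * mat_of_cols n bs = 1\<^sub>m n"
  proof (rule eq_matI)
    fix i j assume "i < dim_row (1\<^sub>m n :: complex mat)" "j < dim_col (1\<^sub>m n :: complex mat)"
    then have ij: "i < n" "j < n" by auto
    have "(mat_adjoint (mat_of_cols n bs) * mat_of_cols n bs) $$ (i, j) = bs ! j \<bullet>c bs ! i"
      using ij c len bs[OF ij(1)] bs[OF ij(2)]
      by (simp add: scalar_prod_def mat_of_cols_index mult.commute)
    then show "(mat_adjoint (mat_of_cols n bs) * mat_of_cols n bs) $$ (i, j) = 1\<^sub>m n $$ (i, j)"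
      using orth ij by auto
  qed (use len in auto)
qed

lemma cscalar_prod_self:
  fixes v :: "complex vec"
  shows "v \<bullet>c v = of_real (\<Sum>i<dim_vec v. (cmod (v $ i))\<^sup>2)"
  by (simp add: scalar_prod_def lessThan_atLeast0 flip: complex_norm_square)

text \<open>Gram-Schmidt applied to a completion of \<open>v\<close> keeps \<open>v\<close> in front
  but yields merely orthogonal vectors, so they are normalised afterwards; this leaves the unit
  vector \<open>v\<close> unchanged.\<close>

lemma orthonormal_basis_extension:
  fixes v :: "complex vec"
  assumes v: "v \<in> carrier_vec n" and unit: "v \<bullet>c v = 1"
  obtains bs where "orthonormal_basis n bs" "bs ! 0 = v"
proof -
  have v0: "v \<noteq> 0\<^sub>v n" using unit v by auto
  interpret cof_vec_space n "TYPE(complex)" .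
  define b where "b = basis_completion v"
  define ws where "ws = gram_schmidt n b"
  note bc = basis_completion[OF v v0, folded b_def]
  have n: "n > 0" using v v0 by (cases n) auto
  then obtain vs where b: "b = v # vs" using bc(6,7) by (cases b) auto
  note gs = gram_schmidt_result[OF bc(2) bc(4) bc(5) refl, folded ws_def]
  have len: "length ws = n" using gs bc by simp
  have "ws \<noteq> []" using len n by auto
  then have hd: "ws ! 0 = v"
    using gram_schmidt_hd[OF v, of vs] unfolding ws_def b by (simp flip: hd_conv_nth)
  \<comment> \<open>The reciprocal of the norm of \<open>w\<close>, as a complex scalar.\<close>
  define c where "c w = complex_of_real (1 / sqrt (\<Sum>i<n. (cmod (w $ i))\<^sup>2))" for w :: "complex vec"
  define bs where "bs = map (\<lambda>w. c w \<cdot>\<^sub>v w) ws"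
  have ws: "ws ! j \<in> carrier_vec n" if "j < n" for j using gs(3) len that by auto
  have ws2: "ws ! j \<bullet>c ws ! k = 0 \<longleftrightarrow> j \<noteq> k" if "j < n" "k < n" for j k
    using gs(2) len that by (auto simp: corthogonal_def)
  have "orthonormal_basis n bs"
    unfolding orthonormal_basis_def
  proof (intro conjI allI impI)
    show "length bs = n" by (simp add: bs_def len)
    show "set bs \<subseteq> carrier_vec n" using gs(3) by (auto simp: bs_def)
    fix j k assume jk: "j < n" "k < n"
    have "bs ! j \<bullet>c bs ! k = c (ws ! j) * cnj (c (ws ! k)) * (ws ! j \<bullet>c ws ! k)"
      using ws[OF jk(1)] ws[OF jk(2)] jk len
      by (simp add: bs_def scalar_prod_def sum_distrib_left ac_simps)
    also have "\<dots> = (if j = k then 1 else 0)"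
    proof (cases "j = k")
      case True
      define s where "s = (\<Sum>i<n. (cmod (ws ! k $ i))\<^sup>2)"
      have s: "ws ! k \<bullet>c ws ! k = of_real s" using ws[OF jk(2)] by (simp add: cscalar_prod_self s_def)
      have "s \<noteq> 0" using ws2[OF jk(2) jk(2)] s by auto
      moreover have "s \<ge> 0" by (simp add: s_def sum_nonneg)
      ultimately have "1 / sqrt s * (1 / sqrt s) * s = 1" by (simp add: real_sqrt_mult_self field_simps)
      moreover have "c (ws ! j) * cnj (c (ws ! k)) * (ws ! j \<bullet>c ws ! k) = of_real (1 / sqrt s * (1 / sqrt s) * s)"
        unfolding True s c_def s_def[symmetric] by (simp only: complex_cnj_complex_of_real of_real_mult)
      ultimately show ?thesis using True by simp
    qed (use ws2 jk in auto)
    finally show "bs ! j \<bullet>c bs ! k = (if j = k then 1 else 0)" .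
  qed
  moreover have "bs ! 0 = v"
  proof -
    have "(\<Sum>i<n. (cmod (v $ i))\<^sup>2) = 1"
      using unit v by (simp add: cscalar_prod_self flip: of_real_sum of_real_power)
    then have "c v = 1" by (simp add: c_def)
    then show ?thesis using len n hd by (simp add: bs_def)
  qed
  ultimately show thesis by (rule that)
qed

lemma unit_eigenvector_exists:
  assumes A: "A \<in> carrier_mat n n" and n: "n > 0"
  obtains c :: complex and v where "v \<in> carrier_vec n" "v \<bullet>c v = 1" "A *\<^sub>v v = c \<cdot>\<^sub>v v"
proof -
  from spectrum_non_empty[OF A n] obtain c w where w: "eigenvector A w c"
    by (auto simp: spectrum_def eigenvalue_def)
  then have wc: "w \<in> carrier_vec n" and w0: "w \<noteq> 0\<^sub>v n" and ev: "A *\<^sub>v w = c \<cdot>\<^sub>v w"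
    using A by (auto simp: eigenvector_def)
  define s where "s = (\<Sum>i<n. (cmod (w $ i))\<^sup>2)"
  have s: "w \<bullet>c w = of_real s" using wc by (simp add: cscalar_prod_self s_def)
  have "s \<noteq> 0" using conjugate_square_eq_0_vec[OF wc] w0 s by auto
  moreover have "s \<ge> 0" by (simp add: s_def sum_nonneg)
  ultimately have s1: "1 / sqrt s * (1 / sqrt s) * s = 1" by (simp add: real_sqrt_mult_self field_simps)
  define a where "a = complex_of_real (1 / sqrt s)"
  have "(a \<cdot>\<^sub>v w) \<bullet>c (a \<cdot>\<^sub>v w) = a * cnj a * (w \<bullet>c w)"
    using wc by (simp add: scalar_prod_def sum_distrib_left ac_simps)
  also have "\<dots> = of_real (1 / sqrt s * (1 / sqrt s) * s)"
    unfolding a_def s by (simp only: complex_cnj_complex_of_real of_real_mult)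
  finally have "(a \<cdot>\<^sub>v w) \<bullet>c (a \<cdot>\<^sub>v w) = 1" using s1 by simp
  moreover have "A *\<^sub>v (a \<cdot>\<^sub>v w) = c \<cdot>\<^sub>v (a \<cdot>\<^sub>v w)"
    using A wc by (simp add: mult_mat_vec ev smult_smult_assoc mult.commute)
  ultimately show thesis using wc by (intro that[of "a \<cdot>\<^sub>v w" c]) auto
qed

lemma unitary_conjugate:
  assumes U: "unitary_mat n U" and A: "A \<in> carrier_mat n n" and B: "mat_adjoint U * A * U = B"
  shows "A = U * B * mat_adjoint U"
proof -
  define V where "V = mat_adjoint U"
  have c: "U \<in> carrier_mat n n" "V \<in> carrier_mat n n"
    using unitary_carrier[OF U] by (auto simp: V_def)
  have UV: "U * V = 1\<^sub>m n" using U by (simp add: unitary_mat_def V_def)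
  have "U * B * V = (U * V) * (A * (U * V))"
    unfolding B[symmetric] V_def[symmetric] using A c by (simp add: assoc_mult_mat[of _ n n _ n _ n])
  then show ?thesis using A UV by (simp add: V_def)
qed

lemma mult_mat_nested:
  assumes "A \<in> carrier_mat n n" "B \<in> carrier_mat n n" "C \<in> carrier_mat n n" "D \<in> carrier_mat n n"
    "E \<in> carrier_mat n n"
  shows "A * (B * C * D) * E = (A * B) * C * (D * E)"
  using assms by (simp add: assoc_mult_mat[of _ n n _ n _ n])

lemma hermitian_conjugate:
  fixes A U :: "complex mat"
  assumes A: "A \<in> carrier_mat n n" "mat_adjoint A = A" and U: "U \<in> carrier_mat n m"
  shows "mat_adjoint (mat_adjoint U * A * U) = mat_adjoint U * A * U"
proof -
  define V where "V = mat_adjoint U"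
  have "V \<in> carrier_mat m n" "mat_adjoint V = U" using U by (auto simp: V_def)
  then show ?thesis
    using A U unfolding V_def[symmetric]
    by (simp add: mat_adjoint_mult[of _ m n _ m] mat_adjoint_mult[of _ n n _ m] flip: V_def)
qed

text \<open>Deflation: in an orthonormal basis that starts with a unit eigenvector, a Hermitian
  matrix splits into a one-by-one block and a smaller Hermitian block, to which the induction
  hypothesis applies. The eigenvalues are obtained as real numbers because \<open>mat_fun\<close>
  admits only real diagonals.\<close>

lemma hermitian_diagonalizable:
  fixes A :: "complex mat"
  assumes "A \<in> carrier_mat n n" "mat_adjoint A = A"
  shows "\<exists>U e. unitary_mat n U \<and> A = U * mat_diag n (\<lambda>k. complex_of_real (e k)) * mat_adjoint U"
  using assms
proof (induction n arbitrary: A)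
  case 0
  then have "A = 1\<^sub>m 0 * mat_diag 0 (\<lambda>k. complex_of_real 0) * mat_adjoint (1\<^sub>m 0)"
    by (intro eq_matI) auto
  moreover have "unitary_mat 0 (1\<^sub>m 0)" by (simp add: unitary_mat_def)
  ultimately show ?case by (intro exI[of _ "1\<^sub>m 0"] exI[of _ "\<lambda>_. 0"]) auto
next
  case (Suc n)
  obtain c :: complex and v where v: "v \<in> carrier_vec (Suc n)" "v \<bullet>c v = 1" "A *\<^sub>v v = c \<cdot>\<^sub>v v"
    using unit_eigenvector_exists[OF Suc.prems(1)] by blast
  obtain bs where bs: "orthonormal_basis (Suc n) bs" "bs ! 0 = v"
    using orthonormal_basis_extension[OF v(1,2)] by metis
  define U where "U = mat_of_cols (Suc n) bs"
  have U: "unitary_mat (Suc n) U" unfolding U_def by (rule unitary_mat_of_orthonormal_basis[OF bs(1)])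
  note Uc = unitary_carrier[OF U]
  have colU: "col U 0 = v"
    using bs v(1) unfolding U_def by (subst col_mat_of_cols) (auto simp: orthonormal_basis_def)
  define B where "B = mat_adjoint U * A * U"
  have Bc: "B \<in> carrier_mat (Suc n) (Suc n)" unfolding B_def using Uc Suc.prems
    by (intro mult_carrier_mat[of _ "Suc n" "Suc n" _ "Suc n"]) auto
  have Bh: "mat_adjoint B = B"
    unfolding B_def by (rule hermitian_conjugate[OF Suc.prems Uc])
  \<comment> \<open>Column 0 of \<open>U\<close> is the eigenvector, so column 0 of \<open>B\<close>
    is \<open>c\<close> times column 0 of \<open>mat_adjoint U * U\<close>. Hermiticity will then
    clear row 0 as well.\<close>
  have B0: "B $$ (i, 0) = (if i = 0 then c else 0)" if i: "i < Suc n" for i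
  proof -
    have "B = mat_adjoint U * (A * U)"
      unfolding B_def using Uc Suc.prems by (simp add: assoc_mult_mat[of _ "Suc n" "Suc n" _ "Suc n" _ "Suc n"])
    then have "B $$ (i, 0) = row (mat_adjoint U) i \<bullet> (A *\<^sub>v col U 0)"
      using Uc Suc.prems i by (simp add: col_mult2[of _ "Suc n" "Suc n" _ "Suc n"] mult_mat_vec_def)
    also have "\<dots> = c * (row (mat_adjoint U) i \<bullet> col U 0)"
      unfolding colU v(3) using v(1) Uc i by simp
    also have "row (mat_adjoint U) i \<bullet> col U 0 = (mat_adjoint U * U) $$ (i, 0)"
      using Uc i by simp
    also have "\<dots> = (if i = 0 then 1 else 0)" using U i by (simp add: unitary_mat_def)
    finally show ?thesis by simp
  qed
  have Badj: "cnj (B $$ (j, i)) = B $$ (i, j)" if "i < Suc n" "j < Suc n" for i j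
    using arg_cong[OF Bh, of "\<lambda>M. M $$ (i, j)"] Bc that by simp
  \<comment> \<open>\<open>c\<close> is a diagonal entry of the Hermitian matrix
    \<open>B\<close>.\<close>
  have creal: "c = of_real (Re c)"
    using Badj[of 0 0] B0[of 0] by (simp add: complex_eq_iff)
  define B' where "B' = mat n n (\<lambda>(i, j). B $$ (Suc i, Suc j))"
  have B'c: "B' \<in> carrier_mat n n" by (simp add: B'_def)
  have "mat_adjoint B' = B'"
    by (rule eq_matI) (auto simp: B'_def Badj)
  from Suc.IH[OF B'c this] obtain V e where V: "unitary_mat n V"
    and B'V: "B' = V * mat_diag n (\<lambda>k. complex_of_real (e k)) * mat_adjoint V" by blast
  note Vc = unitary_carrier[OF V]
  \<comment> \<open>Padding \<open>V\<close> with a 1 diagonalises the lower block and leaves the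
    eigenvector already found in place.\<close>
  define W where "W = four_block_mat (1\<^sub>m 1) (0\<^sub>m 1 n) (0\<^sub>m n 1) V"
  have Wa: "mat_adjoint W = four_block_mat (1\<^sub>m 1) (0\<^sub>m 1 n) (0\<^sub>m n 1) (mat_adjoint V)"
    by (rule eq_matI) (use Vc in \<open>auto simp: W_def\<close>)
  have W1: "W \<in> carrier_mat (1 + n) (1 + n)" unfolding W_def using Vc by (intro four_block_carrier_mat) auto
  have W: "unitary_mat (Suc n) W"
  proof (rule unitary_matI)
    show "W \<in> carrier_mat (Suc n) (Suc n)" using W1 by simp
    have "mat_adjoint W * W = four_block_mat (1\<^sub>m 1) (0\<^sub>m 1 n) (0\<^sub>m n 1) (1\<^sub>m n)"
      unfolding Wa unfolding W_def using Vc V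
      by (subst mult_four_block_mat[of _ 1 1 _ n _ n _ _ 1 _ n]) (auto simp: unitary_mat_def)
    then show "mat_adjoint W * W = 1\<^sub>m (Suc n)" by simp
  qed
  define D where "D = mat_diag n (\<lambda>k. complex_of_real (e k))"
  have Dc: "D \<in> carrier_mat n n" by (simp add: D_def)
  define e' where "e' k = (case k of 0 \<Rightarrow> Re c | Suc k \<Rightarrow> e k)" for k
  have D': "mat_diag (Suc n) (\<lambda>k. complex_of_real (e' k)) =
      four_block_mat (mat 1 1 (\<lambda>_. c)) (0\<^sub>m 1 n) (0\<^sub>m n 1) D"
    by (rule eq_matI) (use creal in \<open>auto simp: mat_diag_def D_def e'_def split: nat.splits\<close>)
  have B2: "B = four_block_mat (mat 1 1 (\<lambda>_. c)) (0\<^sub>m 1 n) (0\<^sub>m n 1) B'"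
  proof (rule eq_matI)
    fix i j assume "i < dim_row (four_block_mat (mat 1 1 (\<lambda>_. c)) (0\<^sub>m 1 n) (0\<^sub>m n 1) B')"
      "j < dim_col (four_block_mat (mat 1 1 (\<lambda>_. c)) (0\<^sub>m 1 n) (0\<^sub>m n 1) B')"
    then have ij: "i < Suc n" "j < Suc n" by (auto simp: B'_def)
    then show "B $$ (i, j) = four_block_mat (mat 1 1 (\<lambda>_. c)) (0\<^sub>m 1 n) (0\<^sub>m n 1) B' $$ (i, j)"
      using B0[of i] Badj[of i j] B0[of j] by (cases i; cases j) (auto simp: B'_def)
  qed (use Bc in \<open>auto simp: B'_def\<close>)
  have VDV: "V * D * mat_adjoint V \<in> carrier_mat n n"
    using Vc Dc by (rule sandwich_carrier)
  have BW: "B = W * mat_diag (Suc n) (\<lambda>k. complex_of_real (e' k)) * mat_adjoint W"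
    unfolding B2 D' Wa unfolding W_def B'V D_def[symmetric] using Vc Dc
    by (subst mult_four_block_mat[of _ 1 1 _ n _ n _ _ 1 _ n]; (simp; fail)?)
      (subst mult_four_block_mat[of _ 1 1 _ n _ n _ _ 1 _ n]; simp add: left_add_zero_mat[OF VDV])
  have "A = U * B * mat_adjoint U"
    by (rule unitary_conjugate[OF U Suc.prems(1) B_def[symmetric]])
  also have "\<dots> = (U * W) * mat_diag (Suc n) (\<lambda>k. complex_of_real (e' k)) * mat_adjoint (U * W)"
    using unitary_carrier[OF U] unitary_carrier[OF W]
    unfolding BW mat_adjoint_mult[OF unitary_carrier[OF U] unitary_carrier[OF W]]
    by (intro mult_mat_nested) auto
  finally show ?case using unitary_mult[OF U W] by blast
qed

section \<open>Entropy\<close>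

lemma mat_diag_mult_entries:
  assumes "X \<in> carrier_mat n n" "i < n" "j < n"
  shows "(mat_diag n f * X) $$ (i, j) = f i * X $$ (i, j)" "(X * mat_diag n f) $$ (i, j) = X $$ (i, j) * f j"
  using assms by (auto simp: mat_diag_mult_left[of _ n n] mat_diag_mult_right[of _ n n])

text \<open>Rows come from \<open>W * mat_adjoint W\<close> and columns from the opposite product;
  together they make the squared moduli doubly stochastic.\<close>

lemma unitary_row_col_norm:
  assumes W: "unitary_mat n W" and i: "i < n"
  shows "(\<Sum>j<n. (cmod (W $$ (i, j)))\<^sup>2) = 1" "(\<Sum>j<n. (cmod (W $$ (j, i)))\<^sup>2) = 1"
proof -
  note c = unitary_carrier[OF W]
  have "(W * mat_adjoint W) $$ (i, i) = 1" "(mat_adjoint W * W) $$ (i, i) = 1"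
    using W i by (auto simp: unitary_mat_def)
  then have "(\<Sum>j<n. W $$ (i, j) * cnj (W $$ (i, j))) = 1" "(\<Sum>j<n. W $$ (j, i) * cnj (W $$ (j, i))) = 1"
    using c i by (simp_all add: scalar_prod_def lessThan_atLeast0 mult.commute)
  then have "complex_of_real (\<Sum>j<n. (cmod (W $$ (i, j)))\<^sup>2) = 1" "complex_of_real (\<Sum>j<n. (cmod (W $$ (j, i)))\<^sup>2) = 1"
    by (simp_all flip: complex_norm_square)
  then show "(\<Sum>j<n. (cmod (W $$ (i, j)))\<^sup>2) = 1" "(\<Sum>j<n. (cmod (W $$ (j, i)))\<^sup>2) = 1"
    by (simp_all only: of_real_eq_1_iff)
qed

text \<open>
  The unitary \<open>W = P\<^sup>\<dagger> Q\<close> intertwines the two diagonal matrices, so \<open>W\<^sub>i\<^sub>j\<close> vanishes unless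
  \<open>e\<^sub>i = e'\<^sub>j\<close>, and its squared moduli form a doubly stochastic matrix.
\<close>

lemma diagonalization_sum_unique:
  fixes e e' :: "nat \<Rightarrow> real" and g :: "real \<Rightarrow> real"
  assumes P: "unitary_mat n P" and Q: "unitary_mat n Q"
    and eq: "P * mat_diag n (\<lambda>k. complex_of_real (e k)) * mat_adjoint P =
      Q * mat_diag n (\<lambda>k. complex_of_real (e' k)) * mat_adjoint Q"
  shows "(\<Sum>k<n. g (e k)) = (\<Sum>k<n. g (e' k))"
proof -
  define D where "D = mat_diag n (\<lambda>k. complex_of_real (e k))"
  define E where "E = mat_diag n (\<lambda>k. complex_of_real (e' k))"
  define P' where "P' = mat_adjoint P"
  define Q' where "Q' = mat_adjoint Q"
  define W where "W = P' * Q"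
  have c: "P \<in> carrier_mat n n" "Q \<in> carrier_mat n n" "P' \<in> carrier_mat n n" "Q' \<in> carrier_mat n n"
    "D \<in> carrier_mat n n" "E \<in> carrier_mat n n"
    using unitary_carrier[OF P] unitary_carrier[OF Q] by (auto simp: D_def E_def P'_def Q'_def)
  have "unitary_mat n P'" using P by (auto simp: unitary_mat_def P'_def)
  then have W: "unitary_mat n W" unfolding W_def by (rule unitary_mult[OF _ Q])
  note Wc = unitary_carrier[OF W]
  have "D * W = (P' * P) * D * P' * Q"
    using c P unfolding W_def by (simp add: unitary_mat_def P'_def[symmetric] assoc_mult_mat[of _ n n _ n _ n])
  also have "\<dots> = P' * (P * D * P') * Q"
    using c by (simp add: assoc_mult_mat[of _ n n _ n _ n])
  also have "\<dots> = P' * (Q * E * Q') * Q"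
    using eq by (simp add: P'_def Q'_def D_def E_def)
  also have "\<dots> = W * E * (Q' * Q)"
    using c unfolding W_def by (simp add: assoc_mult_mat[of _ n n _ n _ n])
  also have "\<dots> = W * E"
    using c Wc Q by (simp add: unitary_mat_def Q'_def[symmetric])
  finally have DW: "D * W = W * E" .
  have ent: "(cmod (W $$ (i, j)))\<^sup>2 * g (e i) = (cmod (W $$ (i, j)))\<^sup>2 * g (e' j)" if "i < n" "j < n" for i j
  proof -
    have "complex_of_real (e i) * W $$ (i, j) = W $$ (i, j) * complex_of_real (e' j)"
      using arg_cong[OF DW, of "\<lambda>M. M $$ (i, j)"] mat_diag_mult_entries[OF Wc that]
      by (simp add: D_def E_def)
    then show ?thesis by auto
  qed
  have "(\<Sum>i<n. g (e i)) = (\<Sum>i<n. (\<Sum>j<n. (cmod (W $$ (i, j)))\<^sup>2) * g (e i))"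
    using unitary_row_col_norm(1)[OF W] by (intro sum.cong) auto
  also have "\<dots> = (\<Sum>i<n. \<Sum>j<n. (cmod (W $$ (i, j)))\<^sup>2 * g (e' j))"
    unfolding sum_distrib_right using ent by (intro sum.cong) auto
  also have "\<dots> = (\<Sum>j<n. \<Sum>i<n. (cmod (W $$ (i, j)))\<^sup>2 * g (e' j))"
    by (rule sum.swap)
  also have "\<dots> = (\<Sum>j<n. (\<Sum>i<n. (cmod (W $$ (i, j)))\<^sup>2) * g (e' j))"
    by (simp add: sum_distrib_right)
  also have "\<dots> = (\<Sum>j<n. g (e' j))"
    using unitary_row_col_norm(2)[OF W] by (intro sum.cong) auto
  finally show ?thesis .
qed

lemma mat_trace_unitary_conj:
  assumes U: "unitary_mat n U" and X: "X \<in> carrier_mat n n"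
  shows "mat_trace (U * X * mat_adjoint U) = mat_trace X"
proof -
  define V where "V = mat_adjoint U"
  have c: "U \<in> carrier_mat n n" "V \<in> carrier_mat n n"
    using unitary_carrier[OF U] by (auto simp: V_def)
  have "mat_trace (U * X * V) = mat_trace (V * (U * X))"
    using c X by (intro mat_trace_mult_comm[of _ n n]) auto
  also have "V * (U * X) = X" unfolding V_def using unitary_cancel[OF U X] by simp
  finally show ?thesis by (simp add: V_def)
qed

text \<open>The choice inside \<open>mat_fun\<close> may pick another unitary and another order of
  the eigenvalues than the given ones. The entropy is computed with the selected diagonalisation and
  then transferred by \<open>diagonalization_sum_unique\<close>.\<close>

lemma vn_entropy_diagonalization:
  assumes U: "unitary_mat n U"
    and \<rho>: "\<rho> = U * mat_diag n (\<lambda>k. complex_of_real (e k)) * mat_adjoint U"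
  shows "vn_entropy \<rho> = - (\<Sum>k<n. e k * log 2 (e k))"
proof -
  have dim: "dim_row \<rho> = n" using \<rho> unitary_carrier[OF U] by auto
  \<comment> \<open>The predicate under the choice operator, with the size fixed to
    \<open>n\<close>; the given diagonalisation shows that it is satisfiable.\<close>
  define R where "R B \<longleftrightarrow> (\<exists>U (e :: nat \<Rightarrow> real). unitary_mat n U \<and>
     \<rho> = U * mat_diag n (\<lambda>k. of_real (e k)) * mat_adjoint U \<and>
     B = U * mat_diag n (\<lambda>k. of_real (log 2 (e k))) * mat_adjoint U)" for B
  have "R (U * mat_diag n (\<lambda>k. complex_of_real (log 2 (e k))) * mat_adjoint U)"
    unfolding R_def using U \<rho> by blast
  then have "R (SOME B. R B)" by (rule someI)
  moreover have "mat_fun (log 2) \<rho> = (SOME B. R B)"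
    unfolding mat_fun_def R_def dim ..
  ultimately obtain V e' where V: "unitary_mat n V"
    and \<rho>': "\<rho> = V * mat_diag n (\<lambda>k. complex_of_real (e' k)) * mat_adjoint V"
    and B: "mat_fun (log 2) \<rho> = V * mat_diag n (\<lambda>k. complex_of_real (log 2 (e' k))) * mat_adjoint V"
    unfolding R_def by auto
  define D where "D = mat_diag n (\<lambda>k. complex_of_real (e' k))"
  define L where "L = mat_diag n (\<lambda>k. complex_of_real (log 2 (e' k)))"
  define V' where "V' = mat_adjoint V"
  have c: "V \<in> carrier_mat n n" "V' \<in> carrier_mat n n" "D \<in> carrier_mat n n" "L \<in> carrier_mat n n"
    using unitary_carrier[OF V] by (auto simp: V'_def D_def L_def)
  have "\<rho> * mat_fun (log 2) \<rho> = (V * D * V') * (V * L * V')"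
    using \<rho>' B unfolding V'_def D_def L_def by (rule arg_cong2)
  also have "\<dots> = V * D * (V' * V) * L * V'"
    using c by (simp add: assoc_mult_mat[of _ n n _ n _ n])
  also have "\<dots> = V * (D * L) * V'"
    using V c by (simp add: unitary_mat_def V'_def[symmetric] assoc_mult_mat[of _ n n _ n _ n])
  finally have "mat_trace (\<rho> * mat_fun (log 2) \<rho>) = mat_trace (V * (D * L) * V')" by simp
  also have "\<dots> = mat_trace (D * L)"
    unfolding V'_def using c by (intro mat_trace_unitary_conj[OF V]) simp
  also have "\<dots> = (\<Sum>k<n. complex_of_real (e' k * log 2 (e' k)))"
    unfolding D_def L_def mat_diag_diag by (subst mat_trace_eq_sum[of _ n]) (auto simp: mat_diag_def)
  finally have "vn_entropy \<rho> = - (\<Sum>k<n. e' k * log 2 (e' k))"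
    by (simp add: vn_entropy_def)
  then show ?thesis
    using diagonalization_sum_unique[OF V U trans[OF sym[OF \<rho>'] \<rho>], of "\<lambda>x. x * log 2 x"] by simp
qed

text \<open>The eigenvalue \<open>e k\<close> is the quadratic form of \<open>\<rho>\<close> at
  column \<open>k\<close> of \<open>U\<close>, hence nonnegative; the trace is invariant under
  unitary conjugation, hence the eigenvalues sum to 1.\<close>

lemma density_operator_diagonalization:
  assumes \<rho>: "density_operator n \<rho>"
  obtains U e where "unitary_mat n U" "\<rho> = U * mat_diag n (\<lambda>k. complex_of_real (e k)) * mat_adjoint U"
    "\<And>k. k < n \<Longrightarrow> 0 \<le> e k" "(\<Sum>k<n. e k) = 1"
proof -
  have \<rho>c: "\<rho> \<in> carrier_mat n n" using \<rho> by (simp add: density_operator_def)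
  obtain U e where U: "unitary_mat n U"
    and \<rho>U: "\<rho> = U * mat_diag n (\<lambda>k. complex_of_real (e k)) * mat_adjoint U"
    using hermitian_diagonalizable[OF \<rho>c] \<rho> by (auto simp: density_operator_def)
  define D where "D = mat_diag n (\<lambda>k. complex_of_real (e k))"
  have Uc: "U \<in> carrier_mat n n" and Dc: "D \<in> carrier_mat n n"
    using unitary_carrier[OF U] by (auto simp: D_def)
  have "0 \<le> e k" if k: "k < n" for k
  proof -
    have u: "col U k \<in> carrier_vec n" using Uc k by simp
    have "mat_adjoint U * (\<rho> * U) = D"
    proof -
      define V where "V = mat_adjoint U"
      have V: "V \<in> carrier_mat n n" using Uc by (simp add: V_def)
      have VU: "V * U = 1\<^sub>m n" using U by (simp add: unitary_mat_def V_def)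
      have "V * (\<rho> * U) = (V * U) * D * (V * U)"
        unfolding \<rho>U D_def[symmetric] V_def[symmetric] using Uc Dc V by (simp add: assoc_mult_mat[of _ n n _ n _ n])
      then show ?thesis unfolding VU unfolding V_def using Dc by simp
    qed
    then have "complex_of_real (e k) = (mat_adjoint U * (\<rho> * U)) $$ (k, k)"
      using k by (simp add: D_def mat_diag_def)
    also have "\<dots> = row (mat_adjoint U) k \<bullet> (\<rho> *\<^sub>v col U k)"
      using Uc \<rho>c k by (simp add: col_mult2[of _ n n _ n] mult_mat_vec_def)
    also have "\<dots> = (\<rho> *\<^sub>v col U k) \<bullet>c col U k"
      using Uc \<rho>c k by (simp add: scalar_prod_def[of _ "\<rho> *\<^sub>v _"] scalar_prod_def[of _ "conjugate _"] mult.commute)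
    finally have "e k = Re ((\<rho> *\<^sub>v col U k) \<bullet>c col U k)" by (metis Re_complex_of_real)
    then show ?thesis using \<rho> u by (simp add: density_operator_def)
  qed
  moreover have "(\<Sum>k<n. e k) = 1"
  proof -
    have "1 = mat_trace D"
      using \<rho> mat_trace_unitary_conj[OF U Dc] \<rho>U by (simp add: density_operator_def D_def)
    also have "\<dots> = complex_of_real (\<Sum>k<n. e k)"
      by (subst mat_trace_eq_sum[OF Dc]) (simp add: D_def mat_diag_def)
    finally show ?thesis by (metis of_real_eq_1_iff)
  qed
  ultimately show thesis using U \<rho>U by (intro that)
qed

text \<open>The constant comes from \<open>ln y \<le> y - 1\<close> at \<open>y = 1 / x\<close>,
  which gives \<open>- x * ln x \<le> 1 - x \<le> 1\<close>. At \<open>x = 0\<close> the product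
  vanishes.\<close>

lemma neg_xlogx_bounds:
  fixes x :: real
  assumes "0 \<le> x" "x \<le> 1"
  shows "0 \<le> - (x * log 2 x)" "- (x * log 2 x) \<le> 1 / ln 2"
proof -
  show "0 \<le> - (x * log 2 x)"
    using assms by (cases "x = 0") (auto intro!: mult_nonneg_nonpos)
  show "- (x * log 2 x) \<le> 1 / ln 2"
  proof (cases "x = 0")
    case False
    then have x: "x > 0" using assms by simp
    have "- ln x = ln (1 / x)" using x by (simp add: ln_div)
    also have "\<dots> \<le> 1 / x - 1" using x by (intro ln_le_minus_one) simp
    finally have "x * (- ln x) \<le> x * (1 / x - 1)" using x by (intro mult_left_mono) auto
    also have "\<dots> \<le> 1" using x by (simp add: field_simps)
    finally have "x * (- ln x) / ln 2 \<le> 1 / ln 2" by (intro divide_right_mono) auto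
    then show ?thesis by (simp add: log_def)
  qed auto
qed

text \<open>Each of the \<open>n\<close> eigenvalues lies between 0 and 1 and contributes at most
  \<open>1 / ln 2\<close>. What matters is that the bound depends on the dimension alone.\<close>

lemma vn_entropy_bounds:
  assumes "density_operator n \<rho>"
  shows "0 \<le> vn_entropy \<rho>" "vn_entropy \<rho> \<le> n / ln 2"
proof -
  obtain U e where U: "unitary_mat n U" "\<rho> = U * mat_diag n (\<lambda>k. complex_of_real (e k)) * mat_adjoint U"
    and e: "\<And>k. k < n \<Longrightarrow> 0 \<le> e k" and e1: "(\<Sum>k<n. e k) = 1"
    using density_operator_diagonalization[OF assms] by metis
  have S: "vn_entropy \<rho> = (\<Sum>k<n. - (e k * log 2 (e k)))"
    using vn_entropy_diagonalization[OF U] by (simp add: sum_negf)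
  have e2: "e k \<le> 1" if "k < n" for k
    using e1 member_le_sum[of k "{..<n}" e] e that by auto
  show "0 \<le> vn_entropy \<rho>"
    unfolding S using neg_xlogx_bounds(1) e e2 by (intro sum_nonneg) auto
  have "vn_entropy \<rho> \<le> (\<Sum>k<n. 1 / ln 2)"
    unfolding S using neg_xlogx_bounds(2) e e2 by (intro sum_mono) auto
  then show "vn_entropy \<rho> \<le> n / ln 2" by simp
qed

section \<open>Local measurements and reduced states\<close>

lemma mat_adjoint_projector [simp]: "mat_adjoint (projector v) = projector v"
  by (rule eq_matI) (auto simp: projector_def)

lemma projector_carrier: "v \<in> carrier_vec d \<Longrightarrow> projector v \<in> carrier_mat d d"
  by (auto simp: projector_def)

lemma index_projector: "v \<in> carrier_vec d \<Longrightarrow> i < d \<Longrightarrow> j < d \<Longrightarrow> projector v $$ (i, j) = v $ i * cnj (v $ j)"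
  by (auto simp: projector_def)

text \<open>A rank-one projector compresses every operator to a scalar multiple of itself, the
  scalar being the quadratic form at \<open>v\<close>.\<close>

lemma projector_sandwich:
  assumes v: "v \<in> carrier_vec d" and A: "A \<in> carrier_mat d d"
  shows "projector v * A * projector v = ((A *\<^sub>v v) \<bullet>c v) \<cdot>\<^sub>m projector v"
proof (rule eq_matI)
  note P = projector_carrier[OF v]
  fix i j assume "i < dim_row (((A *\<^sub>v v) \<bullet>c v) \<cdot>\<^sub>m projector v)" "j < dim_col (((A *\<^sub>v v) \<bullet>c v) \<cdot>\<^sub>m projector v)"
  then have ij: "i < d" "j < d" using P by auto
  have "(projector v * A * projector v) $$ (i, j) =
      (\<Sum>x<d. \<Sum>y<d. projector v $$ (i, x) * A $$ (x, y) * projector v $$ (y, j))"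
    using P A ij by (intro index_triple_mult[of _ d d _ d _ d]) auto
  also have "\<dots> = (\<Sum>x<d. \<Sum>y<d. A $$ (x, y) * v $ y * cnj (v $ x)) * (v $ i * cnj (v $ j))"
    using v ij by (simp add: index_projector[of _ d] sum_distrib_right sum_distrib_left ac_simps del: assoc_mult_mat)
  also have "(\<Sum>x<d. \<Sum>y<d. A $$ (x, y) * v $ y * cnj (v $ x)) = (A *\<^sub>v v) \<bullet>c v"
    using A v by (simp add: scalar_prod_def sum_distrib_right lessThan_atLeast0)
  finally show "(projector v * A * projector v) $$ (i, j) = (((A *\<^sub>v v) \<bullet>c v) \<cdot>\<^sub>m projector v) $$ (i, j)"
    using P ij v by (simp add: index_projector[of _ d])
qed (use assms projector_carrier[OF v] in auto)

lemma projector_idem: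
  assumes v: "v \<in> carrier_vec d" and "v \<bullet>c v = 1"
  shows "projector v * projector v = projector v"
proof -
  have "projector v * 1\<^sub>m d * projector v = ((1\<^sub>m d *\<^sub>v v) \<bullet>c v) \<cdot>\<^sub>m projector v"
    by (rule projector_sandwich[OF v]) simp
  then show ?thesis
    using assms projector_carrier[OF v] by (auto simp: smult_one)
qed

lemma mat_trace_projector:
  assumes v: "v \<in> carrier_vec d" and "v \<bullet>c v = 1"
  shows "mat_trace (projector v) = 1"
  using assms by (subst mat_trace_eq_sum[OF projector_carrier[OF v]])
    (simp add: index_projector[OF v] scalar_prod_def lessThan_atLeast0)

text \<open>Orthonormality says that the matrix of basis columns has its adjoint as a left inverse;
  for a square matrix this is also a right inverse, which is the completeness relation.\<close>

lemma orthonormal_basis_complete: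
  assumes bs: "orthonormal_basis d bs" and "u < d" "v < d"
  shows "(\<Sum>b\<leftarrow>bs. b $ u * cnj (b $ v)) = (if u = v then 1 else 0)"
proof -
  have len: "length bs = d" using bs by (simp add: orthonormal_basis_def)
  have "(\<Sum>b\<leftarrow>bs. b $ u * cnj (b $ v)) = (\<Sum>k<d. bs ! k $ u * cnj (bs ! k $ v))"
    by (simp add: sum_list_sum_nth len lessThan_atLeast0)
  also have "\<dots> = (mat_of_cols d bs * mat_adjoint (mat_of_cols d bs)) $$ (u, v)"
    using assms len by (simp add: scalar_prod_def mat_of_cols_index lessThan_atLeast0)
  also have "\<dots> = (if u = v then 1 else 0)"
    using unitary_mat_of_orthonormal_basis[OF bs] assms by (simp add: unitary_mat_def)
  finally show ?thesis .
qed

lemma local_measurementsE: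
  assumes "M \<in> local_measurements d"
  obtains bs where "orthonormal_basis d bs" "M = map projector bs" "length bs = d"
    "\<And>b. b \<in> set bs \<Longrightarrow> b \<in> carrier_vec d" "\<And>b. b \<in> set bs \<Longrightarrow> b \<bullet>c b = 1"
  using assms by (fastforce simp: local_measurements_def orthonormal_basis_def in_set_conv_nth)

lemma local_measurement_hermitian:
  assumes "M \<in> local_measurements d" "P \<in> set M"
  shows "P \<in> carrier_mat d d" "mat_adjoint P = P"
proof -
  obtain bs where "M = map projector bs" "\<And>b. b \<in> set bs \<Longrightarrow> b \<in> carrier_vec d"
    using assms(1) by (rule local_measurementsE) blast
  then show "P \<in> carrier_mat d d" "mat_adjoint P = P"
    using assms(2) by (auto intro: projector_carrier)
qed

text \<open>The sum over \<open>x\<close> produces the squared norm of the basis vector, which is 1;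
  what remains is the completeness relation.\<close>

lemma trace_preserving_local_measurement:
  assumes M: "M \<in> local_measurements d"
  shows "trace_preserving d d M"
  unfolding trace_preserving_def
proof (intro conjI allI impI)
  obtain bs where bs: "orthonormal_basis d bs" "M = map projector bs"
    and car: "\<And>b. b \<in> set bs \<Longrightarrow> b \<in> carrier_vec d" and unit: "\<And>b. b \<in> set bs \<Longrightarrow> b \<bullet>c b = 1"
    using M by (rule local_measurementsE) blast
  show "set M \<subseteq> carrier_mat d d" using local_measurement_hermitian[OF M] by auto
  fix u v assume uv: "u < d" "v < d"
  have "(\<Sum>x<d. kraus_kernel M x u x v) = (\<Sum>b\<leftarrow>bs. \<Sum>x<d. projector b $$ (x, u) * cnj (projector b $$ (x, v)))"
    unfolding sum_sum_list_swap by (simp add: kraus_kernel_def bs(2) o_def)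
  also have "\<dots> = (\<Sum>b\<leftarrow>bs. b $ v * cnj (b $ u))"
  proof (rule sum_list_cong)
    fix b assume b: "b \<in> set bs"
    have "(\<Sum>x<d. projector b $$ (x, u) * cnj (projector b $$ (x, v))) = (\<Sum>x<d. b $ x * cnj (b $ x)) * (b $ v * cnj (b $ u))"
      using uv by (simp add: index_projector[OF car[OF b]] sum_distrib_right sum_distrib_left ac_simps)
    also have "(\<Sum>x<d. b $ x * cnj (b $ x)) = b \<bullet>c b"
      using car[OF b] by (simp add: scalar_prod_def lessThan_atLeast0)
    finally show "(\<Sum>x<d. projector b $$ (x, u) * cnj (projector b $$ (x, v))) = b $ v * cnj (b $ u)"
      using unit[OF b] by simp
  qed
  also have "\<dots> = (if u = v then 1 else 0)"
    using orthonormal_basis_complete[OF bs(1) uv(2,1)] by simp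
  finally show "(\<Sum>x<d. kraus_kernel M x u x v) = (if u = v then 1 else 0)" .
qed

lemma trace_preserving_one: "trace_preserving d d [1\<^sub>m d]"
proof -
  have "(\<Sum>x<d. kraus_kernel [1\<^sub>m d] x u x v) = (if u = v then 1 else 0)" if "u < d" "v < d" for u v
  proof -
    have "(\<Sum>x<d. kraus_kernel [1\<^sub>m d] x u x v) = (\<Sum>x<d. if x = u then (if u = v then 1 else 0) else 0)"
      using that by (intro sum.cong) (auto simp: kraus_kernel_def)
    then show ?thesis using that by simp
  qed
  then show ?thesis by (simp add: trace_preserving_def)
qed

section \<open>The trace of one factor as a Kraus family\<close>

definition bras :: "nat \<Rightarrow> complex mat list" where
  "bras d = map (bra d) [0..<d]"

lemma bras_carrier: "set (bras d) \<subseteq> carrier_mat 1 d"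
  by (auto simp: bras_def bra_def)

text \<open>The row indices are 0 because a bra has a single row; the Kronecker delta is the Choi
  kernel of the trace.\<close>

lemma kraus_kernel_bras:
  assumes "u < d" "v < d"
  shows "kraus_kernel (bras d) 0 u 0 v = (if u = v then 1 else 0)"
proof -
  have "kraus_kernel (bras d) 0 u 0 v = (\<Sum>a<d. (if u = a then 1 else 0) * (if v = a then 1 else 0))"
    using assms
    by (auto simp: kraus_kernel_def bras_def o_def sum_list_distinct_conv_sum_set lessThan_atLeast0
        bra_def mat_of_rows_index intro!: sum.cong)
  also have "\<dots> = (\<Sum>a<d. if a = u then (if u = v then 1 else 0) else 0)"
    by (intro sum.cong) auto
  finally show ?thesis using assms by simp
qed

lemma trace_preserving_bras: "trace_preserving 1 d (bras d)"
  using bras_carrier[of d] by (simp add: trace_preserving_def kraus_kernel_bras)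

text \<open>Contracting with the trace kernel forces \<open>s = t\<close> and leaves exactly the sum
  evaluated by \<open>trace_preserving\<close>. The lists in general differ in length, so only their
  kernels can be compared. This is why measuring a subsystem does not disturb the others.\<close>

lemma same_kernel_bras_mult:
  assumes F: "trace_preserving d d F"
  shows "same_kernel 1 d (pairwise (*) (bras d) F) (bras d)"
proof -
  have Fc: "set F \<subseteq> carrier_mat d d" using F by (simp add: trace_preserving_def)
  have "kraus_kernel (pairwise (*) (bras d) F) 0 u 0 v = kraus_kernel (bras d) 0 u 0 v"
    if uv: "u < d" "v < d" for u v
  proof -
    have "kraus_kernel (pairwise (*) (bras d) F) 0 u 0 v =
        (\<Sum>s<d. \<Sum>t<d. kraus_kernel (bras d) 0 s 0 t * kraus_kernel F s u t v)"
      using uv by (intro kraus_kernel_mult[OF bras_carrier Fc]) auto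
    also have "\<dots> = (\<Sum>s<d. \<Sum>t<d. if t = s then kraus_kernel F s u s v else 0)"
      by (intro sum.cong refl) (auto simp: kraus_kernel_bras)
    also have "\<dots> = (\<Sum>s<d. kraus_kernel F s u s v)"
      by simp
    finally show ?thesis using F uv by (simp add: trace_preserving_def kraus_kernel_bras)
  qed
  moreover have "set (pairwise (*) (bras d) F) \<subseteq> carrier_mat 1 d"
    using bras_carrier[of d] Fc unfolding set_pairwise by (blast intro: mult_carrier_mat)
  ultimately show ?thesis using bras_carrier[of d] by (simp add: same_kernel_def)
qed

lemma pairwise_mult_one:
  fixes F :: "complex mat list"
  assumes "set F \<subseteq> carrier_mat r c"
  shows "pairwise (*) [1\<^sub>m r] F = F" "pairwise (*) F [1\<^sub>m c] = F"
proof -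
  show "pairwise (*) [1\<^sub>m r] F = F"
    unfolding pairwise_def using assms by (auto intro!: map_idI left_mult_one_mat)
  have "pairwise (*) F [1\<^sub>m c] = map (\<lambda>A. A * 1\<^sub>m c) F"
    by (induction F) (auto simp: pairwise_def)
  also have "\<dots> = F" using assms by (auto intro!: map_idI right_mult_one_mat)
  finally show "pairwise (*) F [1\<^sub>m c] = F" .
qed

lemma product_lists_singletons_append:
  "product_lists (map (\<lambda>x. [f x]) xs @ Fs) = map ((@) (map f xs)) (product_lists Fs)"
  by (induction xs) auto

lemma product_lists_append_singletons:
  "product_lists (Fs @ map (\<lambda>x. [f x]) xs) = map (\<lambda>ys. ys @ map f xs) (product_lists Fs)"
proof (induction Fs)
  case Nil
  show ?case using product_lists_singletons_append[of f xs "[]"] by simp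
qed (simp add: map_concat o_def)

lemma map_if_eq_upt:
  assumes "i < n"
  shows "map (\<lambda>k. if k = i then x else f k) [0..<n] = map f [0..<i] @ x # map f [Suc i..<n]"
proof -
  have "[0..<n] = [0..<i] @ i # [Suc i..<n]"
    using assms upt_add_eq_append[of 0 i "n - i"] by (simp add: upt_conv_Cons)
  then show ?thesis by auto
qed

text \<open>Every slot but \<open>i\<close> offers a single choice, so the tuples are indexed by
  \<open>M\<close> alone.\<close>

lemma tensor_family_at:
  assumes "i < n"
  shows "tensor_family (map (\<lambda>k. if k = i then M else [f k]) [0..<n]) =
    map (\<lambda>P. tensor (map f [0..<i] @ P # map f [Suc i..<n])) M"
proof -
  have "product_lists (M # map (\<lambda>k. [f k]) [Suc i..<n]) = map (\<lambda>P. P # map f [Suc i..<n]) M"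
    using product_lists_append_singletons[of "[M]" f "[Suc i..<n]"]
    by (simp add: o_def concat_map_singleton)
  then show ?thesis
    unfolding tensor_family_def map_if_eq_upt[OF assms]
    by (simp add: product_lists_singletons_append o_def)
qed

lemma tensor_ones:
  "tensor (map (\<lambda>_. 1\<^sub>m 1) xs @ As) = tensor As"
  by (induction xs) auto

lemma tensor_family_at_ones:
  assumes "i < n" "set M \<subseteq> carrier_mat d d"
  shows "tensor_family (map (\<lambda>k. if k = i then M else [1\<^sub>m 1]) [0..<n]) = M"
  unfolding tensor_family_at[OF assms(1)] tensor_ones
  using tensor_ones[of "[Suc i..<n]" "[]"] by simp

lemma prod_list_at:
  assumes "i < n"
  shows "prod_list (map (\<lambda>k. if k = i then d else (1 :: nat)) [0..<n]) = d"
  unfolding map_if_eq_upt[OF assms] by (simp add: map_replicate_const)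

lemma prod_list_nth: "prod_list (map ((!) ds) [0..<length ds]) = prod_list ds"
  by (simp add: map_nth)


section \<open>Measurements and reduced states as factorwise Kraus maps\<close>

text \<open>Bridges the measurements, written with the same projector on both sides, and Kraus maps,
  written with an adjoint on the right.\<close>

lemma kraus_map_hermitian:
  assumes "\<And>K. K \<in> set Ks \<Longrightarrow> mat_adjoint K = K"
  shows "kraus_map n Ks \<rho> = mat_sum n n (map (\<lambda>K. K * \<rho> * K) Ks)"
  unfolding kraus_map_def using assms by (intro arg_cong[of _ _ "mat_sum n n"]) simp

lemma measure_at_eq_kraus_map:
  assumes i: "i < length ds" and M: "\<forall>P\<in>set M. mat_adjoint P = P"
  shows "measure_at ds i M \<sigma> = kraus_map (prod_list ds)
    (tensor_family (map (\<lambda>k. if k = i then M else [1\<^sub>m (ds ! k)]) [0..<length ds])) \<sigma>"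
proof -
  have on: "on_subsystem ds i P = tensor (map (\<lambda>k. 1\<^sub>m (ds ! k)) [0..<i] @ P # map (\<lambda>k. 1\<^sub>m (ds ! k)) [Suc i..<length ds])" for P
  proof -
    have "(map 1\<^sub>m ds)[i := P] = map (\<lambda>k. if k = i then P else 1\<^sub>m (ds ! k)) [0..<length ds]"
      by (rule nth_equalityI) (auto simp: nth_list_update)
    then show ?thesis unfolding on_subsystem_def map_if_eq_upt[OF i] by simp
  qed
  have "mat_adjoint (on_subsystem ds i P) = on_subsystem ds i P" if "P \<in> set M" for P
    using M that by (simp add: on tensor_adjoint o_def)
  then have "kraus_map (prod_list ds) (map (on_subsystem ds i) M) \<sigma> = measure_at ds i M \<sigma>"
    by (subst kraus_map_hermitian) (auto simp: measure_at_def o_def)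
  then show ?thesis unfolding tensor_family_at[OF i] on[abs_def] by simp
qed

lemma measure_first_eq_kraus_map:
  assumes "length Ms \<le> length ds" and Ms: "\<forall>M\<in>set Ms. \<forall>P\<in>set M. mat_adjoint P = P"
  shows "measure_first ds Ms \<sigma> = kraus_map (prod_list ds)
    (tensor_family (map (\<lambda>k. if k < length Ms then Ms ! k else [1\<^sub>m (ds ! k)]) [0..<length ds])) \<sigma>"
proof -
  let ?m = "length Ms"
  have fam: "map (\<lambda>k. if k < ?m then Ms ! k else [1\<^sub>m (ds ! k)]) [0..<length ds] = Ms @ map (\<lambda>d. [1\<^sub>m d]) (drop ?m ds)"
    using assms(1) by (intro nth_equalityI) (auto simp: nth_append)
  have adj: "map mat_adjoint Ps = Ps" if "Ps \<in> set (product_lists Ms)" for Ps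
  proof (rule map_idI)
    fix P assume "P \<in> set Ps"
    then obtain j where j: "j < length Ps" "P = Ps ! j" by (auto simp: in_set_conv_nth)
    have "list_all2 (\<lambda>x ys. x \<in> set ys) Ps Ms"
      using that by (simp add: product_lists_set)
    then have "P \<in> set (Ms ! j)" "Ms ! j \<in> set Ms" using j by (auto simp: list_all2_conv_all_nth)
    then show "mat_adjoint P = P" using Ms by blast
  qed
  have "kraus_map (prod_list ds) (map (\<lambda>Ps. tensor (Ps @ map 1\<^sub>m (drop ?m ds))) (product_lists Ms)) \<sigma> =
      measure_first ds Ms \<sigma>"
    by (subst kraus_map_hermitian) (auto simp: measure_first_def o_def Let_def tensor_adjoint adj)
  then show ?thesis
    unfolding fam tensor_family_def by (simp add: product_lists_append_singletons o_def)
qed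

lemma reduced_state_eq_kraus_map:
  "reduced_state ds K \<sigma> = kraus_map (prod_list (map (\<lambda>k. if k \<in> K then ds ! k else 1) [0..<length ds]))
    (tensor_family (map (\<lambda>k. if k \<in> K then [1\<^sub>m (ds ! k)] else bras (ds ! k)) [0..<length ds])) \<sigma>"
  unfolding reduced_state_def kraus_map_def tensor_family_def bras_def Let_def map_map o_def ..

text \<open>The sizes enter through separate equations so that the rule fits goals that mention
  \<open>prod_list ds\<close> or \<open>ds ! i\<close> instead of products over an index
  list.\<close>

lemma kraus_map_tensor_family_comp_nth:
  assumes "\<And>k. k < n \<Longrightarrow> set (F k) \<subseteq> carrier_mat (r k) (m k)"
    and "\<And>k. k < n \<Longrightarrow> set (G k) \<subseteq> carrier_mat (m k) (c k)"
    and "\<And>k. k < n \<Longrightarrow> same_kernel (r k) (c k) (pairwise (*) (F k) (G k)) (H k)"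
    and "\<sigma> \<in> carrier_mat R R" "prod_list (map r [0..<n]) = N" "prod_list (map m [0..<n]) = N'"
    "prod_list (map c [0..<n]) = R"
  shows "kraus_map N (tensor_family (map F [0..<n])) (kraus_map N' (tensor_family (map G [0..<n])) \<sigma>) =
    kraus_map N (tensor_family (map H [0..<n])) \<sigma>"
  using kraus_map_tensor_family_comp[of "[0..<n]" F r m G c H \<sigma>] assms by simp

lemma measurement_choices_take:
  assumes "Ms \<in> measurement_choices (take m ds)" "m \<le> length ds"
  shows "length Ms = m" "\<And>k. k < m \<Longrightarrow> Ms ! k \<in> local_measurements (ds ! k)"
  using assms by (auto simp: measurement_choices_def list_all2_conv_all_nth)

lemma measurement_choices_family:
  assumes "Ms \<in> measurement_choices (take m ds)" "m \<le> length ds"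
  shows "length Ms \<le> length ds" "\<forall>M\<in>set Ms. \<forall>P\<in>set M. mat_adjoint P = P"
    "\<And>k. trace_preserving (ds ! k) (ds ! k) (if k < length Ms then Ms ! k else [1\<^sub>m (ds ! k)])"
    "\<And>k. set (if k < length Ms then Ms ! k else [1\<^sub>m (ds ! k)]) \<subseteq> carrier_mat (ds ! k) (ds ! k)"
proof -
  note Ms = measurement_choices_take[OF assms]
  show "length Ms \<le> length ds" using Ms(1) assms(2) by simp
  show "\<forall>M\<in>set Ms. \<forall>P\<in>set M. mat_adjoint P = P"
    using Ms local_measurement_hermitian(2) by (metis in_set_conv_nth)
  show tp: "trace_preserving (ds ! k) (ds ! k) (if k < length Ms then Ms ! k else [1\<^sub>m (ds ! k)])" for k
    using Ms trace_preserving_local_measurement trace_preserving_one by auto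
  show "set (if k < length Ms then Ms ! k else [1\<^sub>m (ds ! k)]) \<subseteq> carrier_mat (ds ! k) (ds ! k)" for k
    using tp[of k] by (simp only: trace_preserving_def)
qed

lemma density_operator_measure_first:
  assumes \<rho>: "density_operator (prod_list ds) \<rho>"
    and Ms: "Ms \<in> measurement_choices (take m ds)" "m \<le> length ds"
  shows "density_operator (prod_list ds) (measure_first ds Ms \<rho>)"
proof -
  note F = measurement_choices_family[OF Ms]
  have "trace_preserving (prod_list ds) (prod_list ds)
      (tensor_family (map (\<lambda>k. if k < length Ms then Ms ! k else [1\<^sub>m (ds ! k)]) [0..<length ds]))"
    using trace_preserving_tensor_family[of "[0..<length ds]" "(!) ds" "(!) ds"
        "\<lambda>k. if k < length Ms then Ms ! k else [1\<^sub>m (ds ! k)]"] F(3)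
    unfolding prod_list_nth by blast
  then show ?thesis
    unfolding measure_first_eq_kraus_map[OF F(1,2)] using \<rho> by (rule density_operator_kraus_map)
qed

text \<open>Factors before \<open>i\<close> have been measured and then meet the identity, factor
  \<open>i\<close> meets the identity and is then measured, and later factors only see identities.
  Here the Kraus lists agree literally in every factor.\<close>

lemma measure_at_measure_first:
  assumes Ms: "Ms \<in> measurement_choices (take i ds)" and i: "i < length ds"
    and M: "M \<in> local_measurements (ds ! i)" and \<rho>: "\<rho> \<in> carrier_mat (prod_list ds) (prod_list ds)"
  shows "measure_at ds i M (measure_first ds Ms \<rho>) = measure_first ds (Ms @ [M]) \<rho>"
proof -
  note F = measurement_choices_family[OF Ms less_imp_le[OF i]]
  note Ms' = measurement_choices_take[OF Ms less_imp_le[OF i]]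
  have Mc: "set M \<subseteq> carrier_mat (ds ! i) (ds ! i)" and Mh: "\<forall>P\<in>set M. mat_adjoint P = P"
    using local_measurement_hermitian[OF M] by auto
  let ?G = "\<lambda>k. if k < length (Ms @ [M]) then (Ms @ [M]) ! k else [1\<^sub>m (ds ! k)]"
  have "pairwise (*) (if k = i then M else [1\<^sub>m (ds ! k)]) (if k < length Ms then Ms ! k else [1\<^sub>m (ds ! k)]) = ?G k"
    and "set (?G k) \<subseteq> carrier_mat (ds ! k) (ds ! k)" for k
  proof -
    consider "k < i" | "k = i" | "k > i" by linarith
    then have "pairwise (*) (if k = i then M else [1\<^sub>m (ds ! k)]) (if k < length Ms then Ms ! k else [1\<^sub>m (ds ! k)]) = ?G k
      \<and> set (?G k) \<subseteq> carrier_mat (ds ! k) (ds ! k)"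
    proof cases
      case 1
      then show ?thesis using pairwise_mult_one(1)[OF F(4)[of k]] F(4)[of k] Ms'(1) by (simp add: nth_append)
    next
      case 2
      then show ?thesis using pairwise_mult_one(2)[OF Mc] Mc Ms'(1) by (simp add: nth_append)
    next
      case 3
      then show ?thesis using pairwise_mult_one(1)[OF F(4)[of k]] Ms'(1) by (simp add: nth_append)
    qed
    then show "pairwise (*) (if k = i then M else [1\<^sub>m (ds ! k)]) (if k < length Ms then Ms ! k else [1\<^sub>m (ds ! k)]) = ?G k"
      "set (?G k) \<subseteq> carrier_mat (ds ! k) (ds ! k)" by blast+
  qed note G = this
  have "measure_at ds i M (measure_first ds Ms \<rho>) = kraus_map (prod_list ds) (tensor_family (map ?G [0..<length ds])) \<rho>"
    unfolding measure_at_eq_kraus_map[OF i Mh] measure_first_eq_kraus_map[OF F(1,2)]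
  proof (rule kraus_map_tensor_family_comp_nth[where r = "(!) ds" and m = "(!) ds" and c = "(!) ds"])
    show "set (if k = i then M else [1\<^sub>m (ds ! k)]) \<subseteq> carrier_mat (ds ! k) (ds ! k)" for k
      using Mc by simp
    show "set (if k < length Ms then Ms ! k else [1\<^sub>m (ds ! k)]) \<subseteq> carrier_mat (ds ! k) (ds ! k)" for k
      by (rule F(4))
    show "same_kernel (ds ! k) (ds ! k) (pairwise (*) (if k = i then M else [1\<^sub>m (ds ! k)])
        (if k < length Ms then Ms ! k else [1\<^sub>m (ds ! k)])) (?G k)" for k
      unfolding G(1) by (rule same_kernel_refl[OF G(2)])
  qed (use \<rho> in \<open>simp_all add: map_nth\<close>)
  also have "\<dots> = measure_first ds (Ms @ [M]) \<rho>"
    using F(2) Mh Ms'(1) i by (intro measure_first_eq_kraus_map[symmetric]) auto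
  finally show ?thesis .
qed

text \<open>Factor \<open>i\<close> is traced out, and the trace absorbs the trace-preserving family
  \<open>M\<close>; all other factors carry only identities.\<close>

lemma reduced_state_rest_measure_at:
  assumes i: "i < length ds" and M: "M \<in> local_measurements (ds ! i)"
    and \<sigma>: "\<sigma> \<in> carrier_mat (prod_list ds) (prod_list ds)"
  shows "reduced_state ds (- {i}) (measure_at ds i M \<sigma>) = reduced_state ds (- {i}) \<sigma>"
proof -
  have Mc: "set M \<subseteq> carrier_mat (ds ! i) (ds ! i)" and Mh: "\<forall>P\<in>set M. mat_adjoint P = P"
    using local_measurement_hermitian[OF M] by auto
  let ?r = "\<lambda>k. if k \<in> - {i} then ds ! k else 1"
  let ?H = "\<lambda>k. if k \<in> - {i} then [1\<^sub>m (ds ! k)] else bras (ds ! k)"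
  show ?thesis
    unfolding measure_at_eq_kraus_map[OF i Mh] reduced_state_eq_kraus_map
  proof (rule kraus_map_tensor_family_comp_nth[where r = ?r and m = "(!) ds" and c = "(!) ds"])
    show "set (?H k) \<subseteq> carrier_mat (?r k) (ds ! k)" for k
      using bras_carrier[of "ds ! k"] by (cases "k = i") auto
    show "set (if k = i then M else [1\<^sub>m (ds ! k)]) \<subseteq> carrier_mat (ds ! k) (ds ! k)" for k
      using Mc by simp
    show "same_kernel (?r k) (ds ! k) (pairwise (*) (?H k) (if k = i then M else [1\<^sub>m (ds ! k)])) (?H k)" for k
      using same_kernel_bras_mult[OF trace_preserving_local_measurement[OF M]]
      by (cases "k = i") (auto simp: pairwise_mult_one(1)[of "[1\<^sub>m (ds ! k)]" "ds ! k" "ds ! k"] intro: same_kernel_refl)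
  qed (use \<sigma> in \<open>simp_all add: map_nth\<close>)
qed

lemma prod_list_single:
  fixes ds :: "nat list"
  assumes "i < length ds"
  shows "prod_list (map (\<lambda>k. if k \<in> {i} then ds ! k else 1) [0..<length ds]) = ds ! i"
proof -
  have "(if k \<in> {i} then ds ! k else 1) = (if k = i then ds ! i else 1)" for k by simp
  then show ?thesis using prod_list_at[OF assms, of "ds ! i"] by presburger
qed

text \<open>Both sides collapse to the family with \<open>M\<close> at \<open>i\<close> and
  \<open>bras\<close> elsewhere. \<open>M\<close> is an arbitrary list of Hermitian operators of the
  right size, so that an incomplete list such as a single projector is covered too.\<close>

lemma reduced_state_single_measure_at:
  assumes i: "i < length ds" and Mc: "set M \<subseteq> carrier_mat (ds ! i) (ds ! i)"
    and Mh: "\<forall>P\<in>set M. mat_adjoint P = P"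
    and \<sigma>: "\<sigma> \<in> carrier_mat (prod_list ds) (prod_list ds)"
  shows "reduced_state ds {i} (measure_at ds i M \<sigma>) = kraus_map (ds ! i) M (reduced_state ds {i} \<sigma>)"
proof -
  let ?n = "length ds"
  let ?r = "\<lambda>k. if k \<in> {i} then ds ! k else 1"
  let ?H = "\<lambda>k. if k \<in> {i} then [1\<^sub>m (ds ! k)] else bras (ds ! k)"
  let ?J = "\<lambda>k. if k = i then M else bras (ds ! k)"
  \<comment> \<open>After the trace the other factors are one-dimensional; padding with trivial
    factors presents \<open>M\<close> as a tensor family on the reduced state.\<close>
  let ?L = "\<lambda>k. if k = i then M else [1\<^sub>m 1]"
  have r: "prod_list (map ?r [0..<?n]) = ds ! i"
    by (rule prod_list_single[OF i])
  have Hc: "set (?H k) \<subseteq> carrier_mat (?r k) (ds ! k)" for k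
    using bras_carrier[of "ds ! k"] by simp
  have Jc: "set (?J k) \<subseteq> carrier_mat (?r k) (ds ! k)" for k
    using bras_carrier[of "ds ! k"] Mc by simp
  have "reduced_state ds {i} (measure_at ds i M \<sigma>) = kraus_map (ds ! i) (tensor_family (map ?J [0..<?n])) \<sigma>"
    unfolding measure_at_eq_kraus_map[OF i Mh] reduced_state_eq_kraus_map r
  proof (rule kraus_map_tensor_family_comp_nth[where r = ?r and m = "(!) ds" and c = "(!) ds", OF Hc _ _ \<sigma> r])
    show "set (if k = i then M else [1\<^sub>m (ds ! k)]) \<subseteq> carrier_mat (ds ! k) (ds ! k)" for k
      using Mc by simp
    have "pairwise (*) (?H k) (if k = i then M else [1\<^sub>m (ds ! k)]) = ?J k" for k
      using pairwise_mult_one(1)[OF Mc] pairwise_mult_one(2)[OF bras_carrier] by simp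
    then show "same_kernel (?r k) (ds ! k) (pairwise (*) (?H k) (if k = i then M else [1\<^sub>m (ds ! k)])) (?J k)" for k
      using same_kernel_refl[OF Jc] by presburger
  qed (simp_all add: map_nth)
  also have "\<dots> = kraus_map (ds ! i) (tensor_family (map ?L [0..<?n])) (reduced_state ds {i} \<sigma>)"
    unfolding reduced_state_eq_kraus_map r
  proof (rule kraus_map_tensor_family_comp_nth[where r = ?r and m = ?r and c = "(!) ds", OF _ Hc _ \<sigma> r r, symmetric])
    show "set (?L k) \<subseteq> carrier_mat (?r k) (?r k)" for k
      using Mc by simp
    have "pairwise (*) (?L k) (?H k) = ?J k" for k
      using pairwise_mult_one(2)[OF Mc] pairwise_mult_one(1)[OF bras_carrier] by simp
    then show "same_kernel (?r k) (ds ! k) (pairwise (*) (?L k) (?H k)) (?J k)" for k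
      using same_kernel_refl[OF Jc] by presburger
  qed (simp_all add: map_nth)
  also have "tensor_family (map ?L [0..<?n]) = M"
    by (rule tensor_family_at_ones[OF i Mc])
  finally show ?thesis .
qed

lemma trace_preserving_reduced_state_single:
  assumes i: "i < length ds"
  shows "trace_preserving (ds ! i) (prod_list ds)
    (tensor_family (map (\<lambda>k. if k \<in> {i} then [1\<^sub>m (ds ! k)] else bras (ds ! k)) [0..<length ds]))"
proof -
  have "trace_preserving (if k \<in> {i} then ds ! k else 1) (ds ! k)
      (if k \<in> {i} then [1\<^sub>m (ds ! k)] else bras (ds ! k))" for k
    using trace_preserving_one trace_preserving_bras by auto
  then show ?thesis
    using trace_preserving_tensor_family[of "[0..<length ds]" "\<lambda>k. if k \<in> {i} then ds ! k else 1" "(!) ds"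
        "\<lambda>k. if k \<in> {i} then [1\<^sub>m (ds ! k)] else bras (ds ! k)"]
    unfolding prod_list_single[OF i] prod_list_nth by blast
qed

lemma density_operator_reduced_state_single:
  assumes i: "i < length ds" and \<sigma>: "density_operator (prod_list ds) \<sigma>"
  shows "density_operator (ds ! i) (reduced_state ds {i} \<sigma>)"
  unfolding reduced_state_eq_kraus_map prod_list_single[OF i]
  by (rule density_operator_kraus_map[OF trace_preserving_reduced_state_single[OF i] \<sigma>])

lemma mat_trace_reduced_state_single:
  assumes i: "i < length ds" and \<sigma>: "\<sigma> \<in> carrier_mat (prod_list ds) (prod_list ds)"
  shows "mat_trace (reduced_state ds {i} \<sigma>) = mat_trace \<sigma>"
  unfolding reduced_state_eq_kraus_map prod_list_single[OF i]
  by (rule mat_trace_kraus_map[OF trace_preserving_reduced_state_single[OF i] \<sigma>])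

section \<open>Outcome probabilities and the measured marginal\<close>

text \<open>The identities before and after position \<open>i\<close> merge into one identity each,
  of sizes \<open>r\<close> and \<open>s\<close>, so any position is handled as the middle of three
  factors.\<close>

lemma on_subsystem_conv:
  assumes "i < length ds"
  obtains r s where "prod_list ds = r * (ds ! i * s)" "\<And>X. on_subsystem ds i X = kron (1\<^sub>m r) (kron X (1\<^sub>m s))"
proof -
  have kron_tensor: "tensor (map 1\<^sub>m xs @ X # As) = kron (1\<^sub>m (prod_list xs)) (kron X (tensor As))" for xs X As
    by (induction xs) (simp_all add: kron_assoc flip: kron_one)
  have "(map 1\<^sub>m ds)[i := X] = map 1\<^sub>m (take i ds) @ X # map 1\<^sub>m (drop (Suc i) ds)" for X :: "complex mat"
    using assms by (simp add: upd_conv_take_nth_drop take_map drop_map)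
  then have "on_subsystem ds i X = kron (1\<^sub>m (prod_list (take i ds))) (kron X (1\<^sub>m (prod_list (drop (Suc i) ds))))" for X
    by (simp add: on_subsystem_def kron_tensor tensor_one)
  moreover have "prod_list ds = prod_list (take i ds) * (ds ! i * prod_list (drop (Suc i) ds))"
    using assms by (subst id_take_nth_drop[OF assms]) simp
  ultimately show thesis by (rule that[rotated])
qed

lemma on_subsystem_carrier:
  assumes i: "i < length ds" and X: "X \<in> carrier_mat (ds ! i) (ds ! i)"
  shows "on_subsystem ds i X \<in> carrier_mat (prod_list ds) (prod_list ds)"
proof -
  obtain r s where "prod_list ds = r * (ds ! i * s)" "\<And>X. on_subsystem ds i X = kron (1\<^sub>m r) (kron X (1\<^sub>m s))"
    using on_subsystem_conv[OF i] by blast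
  then show ?thesis using X by (simp add: kron_carrier)
qed

lemma on_subsystem_mult:
  assumes i: "i < length ds" and X: "X \<in> carrier_mat (ds ! i) (ds ! i)" and Y: "Y \<in> carrier_mat (ds ! i) (ds ! i)"
  shows "on_subsystem ds i X * on_subsystem ds i Y = on_subsystem ds i (X * Y)"
proof -
  obtain r s where on: "\<And>X. on_subsystem ds i X = kron (1\<^sub>m r) (kron X (1\<^sub>m s))"
    using on_subsystem_conv[OF i] by blast
  have "kron X (1\<^sub>m s) * kron Y (1\<^sub>m s) = kron (X * Y) (1\<^sub>m s * 1\<^sub>m s)"
    by (rule kron_mult[OF X Y]) auto
  moreover have "kron (1\<^sub>m r) (kron X (1\<^sub>m s)) * kron (1\<^sub>m r) (kron Y (1\<^sub>m s)) =
      kron (1\<^sub>m r * 1\<^sub>m r) (kron X (1\<^sub>m s) * kron Y (1\<^sub>m s))"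
    using X Y by (intro kron_mult[of _ r r _ r _ "ds ! i * s" "ds ! i * s" _ "ds ! i * s"] kron_carrier) auto
  ultimately show ?thesis by (simp add: on)
qed

text \<open>The outcome probability can be read off the reduced state. Idempotence and cyclicity of
  the trace rewrite it as the trace of the state after a single projector, which the reduction
  preserves; there the projector acts on \<open>\<tau>\<close> as a scalar.\<close>

lemma outcome_prob_reduced:
  assumes i: "i < length ds" and b: "b \<in> carrier_vec (ds ! i)" "b \<bullet>c b = 1"
    and \<sigma>: "density_operator (prod_list ds) \<sigma>"
  shows "(reduced_state ds {i} \<sigma> *\<^sub>v b) \<bullet>c b =
    of_real (Re (mat_trace (on_subsystem ds i (projector b) * \<sigma>)))"
proof -
  define P where "P = projector b"
  define Q where "Q = on_subsystem ds i P"
  define \<tau> where "\<tau> = reduced_state ds {i} \<sigma>"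
  have \<sigma>c: "\<sigma> \<in> carrier_mat (prod_list ds) (prod_list ds)" using \<sigma> by (simp add: density_operator_def)
  have Pc: "P \<in> carrier_mat (ds ! i) (ds ! i)" unfolding P_def by (rule projector_carrier[OF b(1)])
  have \<tau>: "density_operator (ds ! i) \<tau>"
    unfolding \<tau>_def by (rule density_operator_reduced_state_single[OF i \<sigma>])
  then have \<tau>c: "\<tau> \<in> carrier_mat (ds ! i) (ds ! i)" by (simp add: density_operator_def)
  note Q = on_subsystem_carrier[OF i Pc, folded Q_def]
  have QQ: "Q * Q = Q"
    unfolding Q_def on_subsystem_mult[OF i Pc Pc] by (simp add: P_def projector_idem[OF b])
  have "mat_trace (Q * \<sigma>) = mat_trace (Q * (Q * \<sigma>))"
    using Q \<sigma>c by (simp add: QQ flip: assoc_mult_mat[of _ "prod_list ds" "prod_list ds" _ "prod_list ds" _ "prod_list ds"])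
  also have "\<dots> = mat_trace ((Q * \<sigma>) * Q)"
    using Q \<sigma>c by (intro mat_trace_mult_comm[of _ "prod_list ds" "prod_list ds"]) auto
  \<comment> \<open>A one-element list is in general not a complete measurement, but reducing it to
    subsystem \<open>i\<close> requires only a Hermitian operator.\<close>
  also have "(Q * \<sigma>) * Q = measure_at ds i [P] \<sigma>"
    using Q \<sigma>c by (simp add: measure_at_def Q_def[symmetric] right_add_zero_mat[of _ "prod_list ds" "prod_list ds"])
  also have "mat_trace \<dots> = mat_trace (reduced_state ds {i} (measure_at ds i [P] \<sigma>))"
    by (rule mat_trace_reduced_state_single[OF i, symmetric]) (simp add: measure_at_def)
  also have "reduced_state ds {i} (measure_at ds i [P] \<sigma>) = kraus_map (ds ! i) [P] \<tau>"
    unfolding \<tau>_def using Pc \<sigma>c by (intro reduced_state_single_measure_at[OF i]) (auto simp: P_def)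
  also have "\<dots> = ((\<tau> *\<^sub>v b) \<bullet>c b) \<cdot>\<^sub>m P"
    using Pc \<tau>c projector_sandwich[OF b(1) \<tau>c]
    by (simp add: kraus_map_def P_def right_add_zero_mat[of _ "ds ! i" "ds ! i"])
  also have "mat_trace \<dots> = (\<tau> *\<^sub>v b) \<bullet>c b"
    using Pc mat_trace_projector[OF b]
    by (simp add: mat_trace_eq_sum[of _ "ds ! i"] P_def[symmetric] flip: sum_distrib_left)
  finally have tr: "mat_trace (Q * \<sigma>) = (\<tau> *\<^sub>v b) \<bullet>c b" .
  \<comment> \<open>The quadratic form of the Hermitian \<open>\<tau>\<close> equals its own
    conjugate, so taking the real part in \<open>outcome_probs\<close> loses nothing.\<close>
  have "(\<tau> *\<^sub>v b) \<bullet>c b = b \<bullet>c (\<tau> *\<^sub>v b)"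
    using cscalar_prod_adjoint[OF \<tau>c b(1) b(1)] \<tau> by (simp add: density_operator_def)
  also have "\<dots> = cnj ((\<tau> *\<^sub>v b) \<bullet>c b)"
    using \<tau>c b(1) by (simp add: scalar_prod_def mult.commute)
  finally have "(\<tau> *\<^sub>v b) \<bullet>c b = of_real (Re ((\<tau> *\<^sub>v b) \<bullet>c b))"
    by (simp add: complex_eq_iff)
  then show ?thesis using tr by (simp add: Q_def P_def \<tau>_def)
qed

text \<open>Each \<open>projector b * \<tau> * projector b\<close> is a multiple of
  \<open>projector b\<close>, so the measured marginal is given in spectral form: the basis vectors
  are the columns of the unitary and the outcome probabilities the eigenvalues.\<close>

lemma vn_entropy_measured_subsystem:
  assumes i: "i < length ds" and M: "M \<in> local_measurements (ds ! i)"
    and \<sigma>: "density_operator (prod_list ds) \<sigma>"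
  shows "vn_entropy (reduced_state ds {i} (measure_at ds i M \<sigma>)) = shannon_entropy (outcome_probs ds i M \<sigma>)"
proof -
  let ?d = "ds ! i"
  define \<tau> where "\<tau> = reduced_state ds {i} \<sigma>"
  have \<sigma>c: "\<sigma> \<in> carrier_mat (prod_list ds) (prod_list ds)" using \<sigma> by (simp add: density_operator_def)
  have \<tau>c: "\<tau> \<in> carrier_mat ?d ?d"
    using density_operator_reduced_state_single[OF i \<sigma>] by (simp add: density_operator_def \<tau>_def)
  obtain bs where bs: "orthonormal_basis ?d bs" "M = map projector bs" "length bs = ?d"
    and car: "\<And>b. b \<in> set bs \<Longrightarrow> b \<in> carrier_vec ?d" and unit: "\<And>b. b \<in> set bs \<Longrightarrow> b \<bullet>c b = 1"
    using M by (rule local_measurementsE) blast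
  define p where "p k = Re (mat_trace (on_subsystem ds i (projector (bs ! k)) * \<sigma>))" for k
  define U where "U = mat_of_cols ?d bs"
  have U: "unitary_mat ?d U" unfolding U_def by (rule unitary_mat_of_orthonormal_basis[OF bs(1)])
  note Uc = unitary_carrier[OF U]
  define D where "D = mat_diag ?d (\<lambda>k. complex_of_real (p k))"
  have Dc: "D \<in> carrier_mat ?d ?d" by (simp add: D_def)
  have Mc: "set M \<subseteq> carrier_mat ?d ?d" and Mh: "\<forall>P\<in>set M. mat_adjoint P = P"
    using local_measurement_hermitian[OF M] by auto
  have "reduced_state ds {i} (measure_at ds i M \<sigma>) = kraus_map ?d M \<tau>"
    unfolding \<tau>_def by (rule reduced_state_single_measure_at[OF i Mc Mh \<sigma>c])
  also have "\<dots> = U * D * mat_adjoint U"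
  proof (rule eq_matI)
    fix x y assume "x < dim_row (U * D * mat_adjoint U)" "y < dim_col (U * D * mat_adjoint U)"
    then have xy: "x < ?d" "y < ?d" using Uc by auto
    have "kraus_map ?d M \<tau> $$ (x, y) = (\<Sum>P\<leftarrow>M. (P * \<tau> * P) $$ (x, y))"
      using Mc \<tau>c xy Mh
      by (subst kraus_map_hermitian, blast, subst index_mat_sum) (auto simp: o_def intro!: mult_carrier_mat[of _ ?d ?d _ ?d])
    also have "\<dots> = (\<Sum>b\<leftarrow>bs. ((\<tau> *\<^sub>v b) \<bullet>c b) * (b $ x * cnj (b $ y)))"
      unfolding bs(2) map_map o_def
    proof (rule sum_list_cong)
      fix b assume b: "b \<in> set bs"
      show "(projector b * \<tau> * projector b) $$ (x, y) = ((\<tau> *\<^sub>v b) \<bullet>c b) * (b $ x * cnj (b $ y))"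
        using projector_sandwich[OF car[OF b] \<tau>c] projector_carrier[OF car[OF b]] xy
        by (simp add: index_projector[OF car[OF b]])
    qed
    also have "\<dots> = (\<Sum>k<?d. of_real (p k) * (bs ! k $ x * cnj (bs ! k $ y)))"
      unfolding sum_list_sum_nth length_map bs(3) lessThan_atLeast0
      using bs(3) outcome_prob_reduced[OF i car unit \<sigma>] by (intro sum.cong) (auto simp: \<tau>_def p_def)
    also have "\<dots> = (U * D * mat_adjoint U) $$ (x, y)"
    proof -
      have "(U * D * mat_adjoint U) $$ (x, y) = (\<Sum>u<?d. \<Sum>v<?d. U $$ (x, u) * D $$ (u, v) * mat_adjoint U $$ (v, y))"
        using Uc Dc xy by (intro index_triple_mult[of _ ?d ?d _ ?d _ ?d]) auto
      also have "\<dots> = (\<Sum>u<?d. \<Sum>v<?d. if v = u then of_real (p u) * (bs ! u $ x * cnj (bs ! u $ y)) else 0)"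
        using Uc xy bs(3) by (intro sum.cong refl) (auto simp: U_def D_def mat_diag_def mat_of_cols_index)
      also have "\<dots> = (\<Sum>k<?d. of_real (p k) * (bs ! k $ x * cnj (bs ! k $ y)))"
        by simp
      finally show ?thesis ..
    qed
    finally show "kraus_map ?d M \<tau> $$ (x, y) = (U * D * mat_adjoint U) $$ (x, y)" .
  qed (use Uc in auto)
  finally have "vn_entropy (reduced_state ds {i} (measure_at ds i M \<sigma>)) = - (\<Sum>k<?d. p k * log 2 (p k))"
    unfolding D_def by (rule vn_entropy_diagonalization[OF U])
  also have "(\<Sum>k<?d. p k * log 2 (p k)) = (\<Sum>q\<leftarrow>outcome_probs ds i M \<sigma>. q * log 2 q)"
    by (simp add: outcome_probs_def bs(2,3) o_def sum_list_sum_nth lessThan_atLeast0 p_def)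
  finally show ?thesis by (simp add: shannon_entropy_def)
qed

section \<open>The discord inequality\<close>

text \<open>The entropy of the rest is the same in both mutual informations, the entropy of the
  unmeasured marginal occurs with both signs, and that of the measured marginal cancels the Shannon
  term. Only the two global entropies survive.\<close>

lemma discord_functional:
  assumes i: "i < length ds" and M: "M \<in> local_measurements (ds ! i)"
    and \<sigma>: "density_operator (prod_list ds) \<sigma>"
  shows "(mutual_information ds i \<sigma> - mutual_information ds i (measure_at ds i M \<sigma>)) +
      (shannon_entropy (outcome_probs ds i M \<sigma>) - vn_entropy (reduced_state ds {i} \<sigma>)) =
    vn_entropy (measure_at ds i M \<sigma>) - vn_entropy \<sigma>"
proof -
  have "\<sigma> \<in> carrier_mat (prod_list ds) (prod_list ds)" using \<sigma> by (simp add: density_operator_def)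
  from reduced_state_rest_measure_at[OF i M this] vn_entropy_measured_subsystem[OF i M \<sigma>]
  show ?thesis by (simp add: mutual_information_def)
qed

lemma density_operator_measure_at:
  assumes i: "i < length ds" and M: "M \<in> local_measurements (ds ! i)"
    and \<sigma>: "density_operator (prod_list ds) \<sigma>"
  shows "density_operator (prod_list ds) (measure_at ds i M \<sigma>)"
proof -
  have Mh: "\<forall>P\<in>set M. mat_adjoint P = P"
    using local_measurement_hermitian[OF M] by auto
  have "trace_preserving (ds ! k) (ds ! k) (if k = i then M else [1\<^sub>m (ds ! k)])" for k
    using trace_preserving_local_measurement[OF M] trace_preserving_one by auto
  then have "trace_preserving (prod_list ds) (prod_list ds)
      (tensor_family (map (\<lambda>k. if k = i then M else [1\<^sub>m (ds ! k)]) [0..<length ds]))"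
    using trace_preserving_tensor_family[of "[0..<length ds]" "(!) ds" "(!) ds"
        "\<lambda>k. if k = i then M else [1\<^sub>m (ds ! k)]"]
    unfolding prod_list_nth by blast
  then show ?thesis
    unfolding measure_at_eq_kraus_map[OF i Mh] using \<sigma> by (rule density_operator_kraus_map)
qed

section \<open>Nonempty index sets and lower bounds for the infima\<close>

lemma local_measurements_nonempty: "local_measurements d \<noteq> {}"
proof -
  have "orthonormal_basis d (map (unit_vec d) [0..<d])"
    by (auto simp: orthonormal_basis_def scalar_prod_left_unit[of _ d])
  then show ?thesis by (auto simp: local_measurements_def)
qed

lemma measurement_choices_nonempty: "measurement_choices ds \<noteq> {}"
proof -
  have "(SOME M. M \<in> local_measurements d) \<in> local_measurements d" for d
    using local_measurements_nonempty by (simp add: some_in_eq)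
  then have "map (\<lambda>d. SOME M. M \<in> local_measurements d) ds \<in> measurement_choices ds"
    by (simp add: measurement_choices_def list_all2_conv_all_nth)
  then show ?thesis by blast
qed

text \<open>The bound involves neither \<open>M\<close> nor the state \<open>\<sigma>\<close> beyond
  its dimension, so the same constant serves the infimum over \<open>M\<close> and the outer infimum
  over earlier measurements.\<close>

lemma discord_functional_ge:
  assumes "i < length ds" "M \<in> local_measurements (ds ! i)" "density_operator (prod_list ds) \<sigma>"
  shows "- (real (prod_list ds) / ln 2) \<le> vn_entropy (measure_at ds i M \<sigma>) - vn_entropy \<sigma>"
  using vn_entropy_bounds(1)[OF density_operator_measure_at[OF assms]] vn_entropy_bounds(2)[OF assms(3)]
  by simp

lemma thermal_discord_eq:
  assumes "i < length ds" "density_operator (prod_list ds) \<sigma>"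
  shows "thermal_discord ds i \<sigma> =
    (INF M \<in> local_measurements (ds ! i). vn_entropy (measure_at ds i M \<sigma>) - vn_entropy \<sigma>)"
  unfolding thermal_discord_def using discord_functional[OF assms(1) _ assms(2)]
  by (intro INF_cong) auto

lemma thermal_discord_le:
  assumes i: "i < length ds" and M: "M \<in> local_measurements (ds ! i)"
    and \<sigma>: "density_operator (prod_list ds) \<sigma>"
  shows "thermal_discord ds i \<sigma> \<le> vn_entropy (measure_at ds i M \<sigma>) - vn_entropy \<sigma>"
  unfolding thermal_discord_eq[OF i \<sigma>]
  using discord_functional_ge[OF i _ \<sigma>] M by (intro cINF_lower bdd_belowI2)

lemma thermal_discord_ge:
  assumes "i < length ds" "density_operator (prod_list ds) \<sigma>"
  shows "- (real (prod_list ds) / ln 2) \<le> thermal_discord ds i \<sigma>"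
  unfolding thermal_discord_eq[OF assms]
  using discord_functional_ge[OF assms(1) _ assms(2)]
  by (intro cINF_greatest local_measurements_nonempty)

lemma measure_first_Nil:
  assumes "\<sigma> \<in> carrier_mat (prod_list ds) (prod_list ds)"
  shows "measure_first ds [] \<sigma> = \<sigma>"
  using assms by (simp add: measure_first_def tensor_one)

theorem theorem2:
  fixes n :: nat and ds :: "nat list" and \<rho> :: "complex mat"
  assumes "n \<ge> 1"
    and "length ds = n"
    and "density_operator (prod_list ds) \<rho>"
  shows "thermal_gqd ds \<rho> \<ge>
    (\<Sum>i<n. if i = 0 then thermal_discord ds 0 \<rho>
           else INF Ms \<in> measurement_choices (take i ds). thermal_discord ds i (measure_first ds Ms \<rho>))"
  unfolding thermal_gqd_def
\<comment> \<open>It suffices to bound the value of every single choice \<open>Ms\<close> from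
  below, so no minimiser has to be produced.\<close>
proof (rule cINF_greatest[OF measurement_choices_nonempty])
  note len = assms(2) and \<rho> = assms(3)
  have \<rho>c: "\<rho> \<in> carrier_mat (prod_list ds) (prod_list ds)" using \<rho> by (simp add: density_operator_def)
  fix Ms assume Ms: "Ms \<in> measurement_choices ds"
  then have lenMs: "length Ms = n" and Msi: "\<And>i. i < n \<Longrightarrow> Ms ! i \<in> local_measurements (ds ! i)"
    using len by (auto simp: measurement_choices_def list_all2_conv_all_nth)
  \<comment> \<open>The state after the first \<open>i\<close> subsystems have been measured:
    \<open>\<sigma> 0\<close> is \<open>\<rho>\<close> and \<open>\<sigma> n\<close> is the fully
    measured state. With numbering from 0, passing from \<open>\<sigma> i\<close> to
    \<open>\<sigma> (Suc i)\<close> measures subsystem \<open>i\<close>.\<close>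
  define \<sigma> where "\<sigma> i = measure_first ds (take i Ms) \<rho>" for i
  have Mt: "take i Ms \<in> measurement_choices (take i ds)" for i
    using Ms by (simp add: measurement_choices_def)
  have dens: "density_operator (prod_list ds) (\<sigma> i)" if "i < n" for i
    unfolding \<sigma>_def using len that by (intro density_operator_measure_first[OF \<rho> Mt]) simp
  have term_le: "(if i = 0 then thermal_discord ds 0 \<rho>
           else INF Ms \<in> measurement_choices (take i ds). thermal_discord ds i (measure_first ds Ms \<rho>))
      \<le> vn_entropy (\<sigma> (Suc i)) - vn_entropy (\<sigma> i)" if i: "i < n" for i
  proof -
    have i': "i < length ds" using i len by simp
    have "(if i = 0 then thermal_discord ds 0 \<rho>
           else INF Ms \<in> measurement_choices (take i ds). thermal_discord ds i (measure_first ds Ms \<rho>))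
      \<le> thermal_discord ds i (\<sigma> i)"
    proof (cases "i = 0")
      case True
      then show ?thesis using measure_first_Nil[OF \<rho>c] by (simp add: \<sigma>_def)
    next
      case False
      \<comment> \<open>The prefix \<open>take i Ms\<close> is one competitor in this infimum.
        Boundedness below holds because every intermediate state is a density operator of the same
        dimension.\<close>
      have "(INF Ms \<in> measurement_choices (take i ds). thermal_discord ds i (measure_first ds Ms \<rho>))
          \<le> thermal_discord ds i (\<sigma> i)"
        unfolding \<sigma>_def
        using thermal_discord_ge[OF i' density_operator_measure_first[OF \<rho> _ less_imp_le[OF i']]]
        by (intro cINF_lower bdd_belowI2 Mt)
      then show ?thesis using False by simp
    qed
    also have "\<dots> \<le> vn_entropy (measure_at ds i (Ms ! i) (\<sigma> i)) - vn_entropy (\<sigma> i)"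
      by (rule thermal_discord_le[OF i' Msi[OF i] dens[OF i]])
    also have "measure_at ds i (Ms ! i) (\<sigma> i) = \<sigma> (Suc i)"
      unfolding \<sigma>_def measure_at_measure_first[OF Mt i' Msi[OF i] \<rho>c]
      using i lenMs by (simp add: take_Suc_conv_app_nth)
    finally show ?thesis .
  qed
  have "(\<Sum>i<n. if i = 0 then thermal_discord ds 0 \<rho>
           else INF Ms \<in> measurement_choices (take i ds). thermal_discord ds i (measure_first ds Ms \<rho>))
      \<le> (\<Sum>i<n. vn_entropy (\<sigma> (Suc i)) - vn_entropy (\<sigma> i))"
    using term_le by (intro sum_mono) simp
  also have "\<dots> = vn_entropy (\<sigma> n) - vn_entropy (\<sigma> 0)"
    by (rule sum_lessThan_telescope)
  also have "\<dots> = vn_entropy (measure_first ds Ms \<rho>) - vn_entropy \<rho>"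
    using lenMs measure_first_Nil[OF \<rho>c] by (simp add: \<sigma>_def)
  finally show "(\<Sum>i<n. if i = 0 then thermal_discord ds 0 \<rho>
           else INF Ms \<in> measurement_choices (take i ds). thermal_discord ds i (measure_first ds Ms \<rho>))
      \<le> vn_entropy (measure_first ds Ms \<rho>) - vn_entropy \<rho>" .
qed

end
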